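(* Let $(X_t)_{t\in\mathbb Z}$ be a strictly stationary sequence of real-valued random variables (generic element $X$) which is regularly varying with index $\alpha>0$, with tail process $(Y_t)$ and spectral tail process $(\Theta_t)_{t\in\mathbb Z}$. Let $(\Lambda_n)$ be a sequence of Borel subsets $\Lambda_n\subset(0,\infty)$ such that $x_n=\inf\Lambda_n\to\infty$ and $n\,\mathbb P(|X_0|>x_n)\to0$, and assume the uniform anti-clustering condition $$\lim_{k\to\infty}\limsup_{n\to\infty}\sup_{x\in\Lambda_n}\mathbb P\Big(\max_{k\le i\le n}|X_i|>x\delta\ \Big|\ |X_0|>x\delta\Big)=0\qquad\text{for every }\delta>0 .$$ Let $(c_l)$ be a cluster functional, i.e. a sequence of non-negative functions $c_l$ on $\mathbb R^l$ satisfying condition $(C_0)$, such that the functions $f_l(x_1,\ldots,x_l)=\mathbf 1_{c_l((x_1-1)_+,\ldots,(x_l-1)_+)>1}$, $l\ge1$, satisfy condition $(C_1)$ (conditions $(C_\varepsilon)$, $\varepsilon\ge0$, are defined in the context). Then, as $n\to\infty$, $$\sup_{x\in\Lambda_n}\left|\frac{\mathbb P\big(c(((x^{-1}X_i-1)_+)_{1\le i\le n})>1\big)}{n\,\mathbb P(|X|>x)}-\Big[\mathbb P\big(c(((|Y_0|\Theta_t-1)_+)_{t\ge0})>1\big)-\mathbb P\big(c(((|Y_0|\Theta_t-1)_+)_{t\ge1})>1\big)\Big]\right|\to0 .$$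
   Context: $z_+=\max(z,0)$. Regular variation. A random vector $V$ is regularly varying with index $\alpha>0$ if there is a random vector $\Theta$ on the unit sphere such that for every $u>0$, $\mathbb P(|V|>ux,\,V/|V|\in\cdot)/\mathbb P(|V|>x)\to u^{-\alpha}\mathbb P(\Theta\in\cdot)$ weakly as $x\to\infty$ ($|\cdot|$ the Euclidean norm). A strictly stationary sequence $(X_t)$ is regularly varying with index $\alpha$ if $(X_1,\ldots,X_k)$ is regularly varying with index $\alpha$ for every $k\ge1$. Equivalently, there is a sequence $(Y_t)_{t\in\mathbb Z}$ (the tail process) with $\mathbb P(|Y_0|>y)=y^{-\alpha}$ for $y>1$ and, for every $k\ge0$, $\mathbb P(x^{-1}(X_{-k},\ldots,X_k)\in\cdot\mid|X_0|>x)\to\mathbb P((Y_{-k},\ldots,Y_k)\in\cdot)$ weakly as $x\to\infty$. The spectral tail process is $\Theta_t=Y_t/|Y_0|$, $t\in\mathbb Z$; it is independent of $|Y_0|$, and $|\Theta_0|=1$. Condition $(C_\varepsilon)$, $\varepsilon\ge0$, for a sequence of functions $g_l$ on $\mathbb R^l$, $l\ge1$, with $g_0=0$: the functions $g_l$ are a.e. continuous and bounded uniformly in $l$, and for $1\le j_1\le j_2\le l$, $g_l(x_1,\ldots,x_l)=g_{j_2-j_1+1}(x_{j_1},\ldots,x_{j_2})$ whenever $|x_i|\le\varepsilon$ for all $i\in\{1,\ldots,j_1-1\}\cup\{j_2+1,\ldots,l\}$; moreover $g_l(x_1,\ldots,x_l)=g_0=0$ if $|x_i|\le\varepsilon$ for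 all $i$. One writes $c$ for $c_l$ when the number of arguments is clear; for an infinite sequence with $x_i=0$ for all $i>l$, $c(x_1,x_2,\ldots)=c_l(x_1,\ldots,x_l)$. (Under the anti-clustering condition $\Theta_t\to0$ as $t\to\infty$, so this applies to the sequences $((|Y_0|\Theta_t-1)_+)_{t}$.)
   Formalization: In (C_1) for f_l, "a.e. continuous" is taken with respect to the laws of (Y_0,…,Y_{l-1}) and (Y_1,…,Y_l), since the claim fails if it means Lebesgue-a.e.; the c_l are assumed Borel measurable. *)

theory Defs
  imports "HOL-Probability.Probability"
begin

text \<open>
  For an index set \<open>I\<close>, the space of vectors \<open>(v\<^sub>i)\<close>, \<open>i \<in> I\<close>, is \<open>I \<rightarrow>\<^sub>E UNIV\<close>, with topology
  \<open>powertop_real I\<close> and Borel structure \<open>vec_borel I\<close>.  In particular \<open>\<real>\<close> to the power \<open>l\<close> is the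
  case \<open>I = {1..l}\<close>, and \<open>L2_set v I\<close> is the Euclidean norm of \<open>v\<close>.
\<close>

abbreviation vec_borel :: "'i set \<Rightarrow> ('i \<Rightarrow> real) measure" where
  "vec_borel I \<equiv> PiM I (\<lambda>_. borel)"

text \<open>Weak convergence of finite measures on the Borel sets of a topological space.\<close>

definition weakly_converges ::
    "'a topology \<Rightarrow> ('b \<Rightarrow> 'a measure) \<Rightarrow> 'a measure \<Rightarrow> 'b filter \<Rightarrow> bool" where
  "weakly_converges T \<mu> \<nu> F \<longleftrightarrow>
     (\<forall>h. continuous_map T euclideanreal h \<and> bounded (h ` topspace T) \<longrightarrow>
        ((\<lambda>x. \<integral>v. h v \<partial>\<mu> x) \<longlongrightarrow> (\<integral>v. h v \<partial>\<nu>)) F)"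


section \<open>Regular variation\<close>

text \<open>
  \<open>S\<close> is the law of the random vector \<open>\<Theta>\<close> on the unit sphere.  The measures on the left of
  the limit are \<open>P(|V| > u x, V/|V| \<in> \<cdot>) / P(|V| > x)\<close>.  If \<open>P(|V| > x)\<close> vanished for large \<open>x\<close>,
  they would be null (since \<open>1 / 0 = 0\<close>) and could not converge to a measure of mass
  \<open>u powr - \<alpha>\<close>.
\<close>

definition regularly_varying_vector ::
    "'a measure \<Rightarrow> real \<Rightarrow> 'i set \<Rightarrow> ('a \<Rightarrow> 'i \<Rightarrow> real) \<Rightarrow> bool" where
  "regularly_varying_vector M \<alpha> I V \<longleftrightarrow>
     \<alpha> > 0 \<and>
     (\<exists>S. prob_space S \<and> sets S = sets (vec_borel I) \<and> (AE v in S. L2_set v I = 1) \<and>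
        (\<forall>u>0. weakly_converges (powertop_real I)
           (\<lambda>x. scale_measure (ennreal (1 / \<P>(\<omega> in M. L2_set (V \<omega>) I > x)))
                  (distr (restrict_space M {\<omega> \<in> space M. L2_set (V \<omega>) I > u * x}) (vec_borel I)
                     (\<lambda>\<omega>. \<lambda>i\<in>I. V \<omega> i / L2_set (V \<omega>) I)))
           (scale_measure (ennreal (u powr - \<alpha>)) S)
           at_top))"

definition strictly_stationary :: "'a measure \<Rightarrow> (int \<Rightarrow> 'a \<Rightarrow> real) \<Rightarrow> bool" where
  "strictly_stationary M X \<longleftrightarrow>
     (\<forall>t. X t \<in> borel_measurable M) \<and>
     (\<forall>h. distr M (vec_borel UNIV) (\<lambda>\<omega> t. X (t + h) \<omega>) = distr M (vec_borel UNIV) (\<lambda>\<omega> t. X t \<omega>))"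

definition regularly_varying_sequence :: "'a measure \<Rightarrow> real \<Rightarrow> (int \<Rightarrow> 'a \<Rightarrow> real) \<Rightarrow> bool" where
  "regularly_varying_sequence M \<alpha> X \<longleftrightarrow>
     (\<forall>k\<ge>1::nat. regularly_varying_vector M \<alpha> {1..int k} (\<lambda>\<omega>. \<lambda>i\<in>{1..int k}. X i \<omega>))"

text \<open>The tail process \<open>Y\<close> may live on a probability space \<open>P\<close> of its own.\<close>

definition tail_process ::
    "'a measure \<Rightarrow> real \<Rightarrow> (int \<Rightarrow> 'a \<Rightarrow> real) \<Rightarrow> 'b measure \<Rightarrow> (int \<Rightarrow> 'b \<Rightarrow> real) \<Rightarrow> bool" where
  "tail_process M \<alpha> X P Y \<longleftrightarrow>
     (\<forall>t. Y t \<in> borel_measurable P) \<and>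
     (\<forall>y>1. \<P>(\<omega> in P. \<bar>Y 0 \<omega>\<bar> > y) = y powr - \<alpha>) \<and>
     (\<forall>k::nat. weakly_converges (powertop_real {- int k..int k})
        (\<lambda>x. distr (uniform_measure M {\<omega> \<in> space M. \<bar>X 0 \<omega>\<bar> > x}) (vec_borel {- int k..int k})
               (\<lambda>\<omega>. \<lambda>i\<in>{- int k..int k}. X i \<omega> / x))
        (distr P (vec_borel {- int k..int k}) (\<lambda>\<omega>. \<lambda>i\<in>{- int k..int k}. Y i \<omega>))
        at_top)"

definition spectral_tail_process :: "(int \<Rightarrow> 'b \<Rightarrow> real) \<Rightarrow> int \<Rightarrow> 'b \<Rightarrow> real" where
  "spectral_tail_process Y t \<omega> = Y t \<omega> / \<bar>Y 0 \<omega>\<bar>"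


section \<open>Cluster functionals\<close>

text \<open>
  \<open>N l\<close> is the set of measures on \<open>\<real>\<close> to the power \<open>l\<close> with respect to which ``almost everywhere''
  is understood.  Borel measurability of the \<open>g\<^sub>l\<close> is tacit in the usual formulation and is
  not implied by continuity almost everywhere.
\<close>

definition condition_C ::
    "(nat \<Rightarrow> (nat \<Rightarrow> real) measure set) \<Rightarrow> real \<Rightarrow> (nat \<Rightarrow> (nat \<Rightarrow> real) \<Rightarrow> real) \<Rightarrow> bool" where
  "condition_C N \<epsilon> g \<longleftrightarrow>
     (\<forall>x \<in> {1..0} \<rightarrow>\<^sub>E UNIV. g 0 x = 0) \<and>
     (\<forall>l\<ge>1. g l \<in> borel_measurable (vec_borel {1..l})) \<and>
     (\<forall>l\<ge>1. \<forall>\<nu>\<in>N l. AE x in \<nu>. topcontinuous_at (powertop_real {1..l}) euclideanreal (g l) x) \<and>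
     (\<exists>B. \<forall>l\<ge>1. \<forall>x \<in> {1..l} \<rightarrow>\<^sub>E UNIV. \<bar>g l x\<bar> \<le> B) \<and>
     (\<forall>l j1 j2. 1 \<le> j1 \<and> j1 \<le> j2 \<and> j2 \<le> l \<longrightarrow>
        (\<forall>x \<in> {1..l} \<rightarrow>\<^sub>E UNIV. (\<forall>i \<in> {1..j1 - 1} \<union> {j2 + 1..l}. \<bar>x i\<bar> \<le> \<epsilon>) \<longrightarrow>
           g l x = g (j2 - j1 + 1) (\<lambda>i\<in>{1..j2 - j1 + 1}. x (j1 + i - 1)))) \<and>
     (\<forall>l\<ge>1. \<forall>x \<in> {1..l} \<rightarrow>\<^sub>E UNIV. (\<forall>i\<in>{1..l}. \<bar>x i\<bar> \<le> \<epsilon>) \<longrightarrow> g l x = 0)"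

definition lebesgue_ref :: "nat \<Rightarrow> (nat \<Rightarrow> real) measure set" where
  "lebesgue_ref l = {PiM {1..l} (\<lambda>_. lborel)}"

text \<open>
  The laws of \<open>(Y\<^sub>0, \<dots>, Y\<^sub>l\<^sub>-\<^sub>1)\<close> and \<open>(Y\<^sub>1, \<dots>, Y\<^sub>l)\<close>, that is, of the first \<open>l\<close> coordinates of
  \<open>(Y\<^sub>t)\<close>, \<open>t \<ge> 0\<close>, and of \<open>(Y\<^sub>t)\<close>, \<open>t \<ge> 1\<close>.
\<close>

definition tail_ref :: "'b measure \<Rightarrow> (int \<Rightarrow> 'b \<Rightarrow> real) \<Rightarrow> nat \<Rightarrow> (nat \<Rightarrow> real) measure set" where
  "tail_ref P Y l =
     (\<lambda>s. distr P (vec_borel {1..l}) (\<lambda>\<omega>. \<lambda>i\<in>{1..l}. Y (s + int i - 1) \<omega>)) ` {0, 1}"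

definition cluster_functional ::
    "(nat \<Rightarrow> (nat \<Rightarrow> real) measure set) \<Rightarrow> (nat \<Rightarrow> (nat \<Rightarrow> real) \<Rightarrow> real) \<Rightarrow> bool" where
  "cluster_functional N c \<longleftrightarrow>
     (\<forall>l\<ge>1. \<forall>x \<in> {1..l} \<rightarrow>\<^sub>E UNIV. c l x \<ge> 0) \<and> condition_C N 0 c"

definition pos_part :: "real \<Rightarrow> real" where
  "pos_part z = max z 0"

definition exceedance_indicator ::
    "(nat \<Rightarrow> (nat \<Rightarrow> real) \<Rightarrow> real) \<Rightarrow> nat \<Rightarrow> (nat \<Rightarrow> real) \<Rightarrow> real" where
  "exceedance_indicator c l x = of_bool (c l (\<lambda>i\<in>{1..l}. pos_part (x i - 1)) > 1)"

text \<open>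
  The value \<open>c(x\<^sub>1, x\<^sub>2, \<dots>)\<close> at a sequence with \<open>x\<^sub>i = 0\<close> for all \<open>i > l\<close>; \<open>x 0\<close> plays no role.
  For a cluster functional the choice of \<open>l\<close> does not matter.  Sequences that are not
  eventually zero get the dummy value 0.
\<close>

definition eval_seq :: "(nat \<Rightarrow> (nat \<Rightarrow> real) \<Rightarrow> real) \<Rightarrow> (nat \<Rightarrow> real) \<Rightarrow> real" where
  "eval_seq c x =
     (if \<exists>l. \<forall>i>l. x i = 0
      then (let l = (LEAST l. \<forall>i>l. x i = 0) in c l (restrict x {1..l}))
      else 0)"

end

theory Submission
  imports Defs
begin

text \<open>
  Write \<open>Q\<^sub>l(z)\<close> for \<open>c\<^sub>l((z\<^sub>1 - 1)\<^sub>+, \<dots>, (z\<^sub>l - 1)\<^sub>+) > 1\<close>.  By stationarity \<open>P(Q\<^sub>n(X\<^sub>1/x, \<dots>, X\<^sub>n/x))\<close> is the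
  telescoping sum over \<open>m \<le> n\<close> of \<open>P(Q\<^sub>m(X\<^sub>0/x, \<dots>)) - P(Q\<^sub>m\<^sub>-\<^sub>1(X\<^sub>1/x, \<dots>))\<close>, and each difference lives
  on \<open>|X\<^sub>0| > x\<close>, because a first entry at most 1 can be dropped.  On this event, replacing \<open>m > k\<close> by
  \<open>k\<close> costs at most the conditional probability in the anti-clustering condition (with \<open>\<delta> = 1\<close>), while
  the \<open>k\<close> short blocks contribute \<open>O(k/n)\<close>.  The remaining conditional probabilities of block length
  \<open>k\<close> converge as \<open>x \<rightarrow> \<infinity>\<close> by almost everywhere continuity.  Finally \<open>k \<rightarrow> \<infinity>\<close>: anti-clustering passes to
  the limit and bounds the probability that \<open>|Y\<^sub>t| > 1\<close> for some \<open>t \<ge> k\<close>.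
\<close>

section \<open>Weak convergence on finite products\<close>

text \<open>Second countability of a finite power: boxes with rational end points form a countable
  base, and each is a measurable rectangle. This links the topology in
  \<open>weakly_converges\<close> to the product sigma-algebra on which the laws live.\<close>

lemma openin_powertop_real_imp_sets:
  fixes I :: "'i set"
  assumes fin: "finite I" and U: "openin (powertop_real I) U"
  shows "U \<in> sets (vec_borel I)"
proof -
  define box where "box = (\<lambda>p :: 'i \<Rightarrow> real \<times> real. \<Pi>\<^sub>E i\<in>I. {fst (p i)<..<snd (p i)})"
  define J where "J = {p \<in> (\<Pi>\<^sub>E i\<in>I. \<rat> \<times> \<rat>). box p \<subseteq> U}"
  have "countable (\<Pi>\<^sub>E i\<in>I. (\<rat> \<times> \<rat> :: (real \<times> real) set))"
    by (intro countable_PiE fin countable_SIGMA countable_rat)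
  then have "countable J"
    unfolding J_def by (rule countable_subset[rotated]) auto
  moreover have "box p \<in> sets (vec_borel I)" for p
    unfolding box_def by (intro sets_PiM_I_finite fin) auto
  moreover have "U = (\<Union>p\<in>J. box p)"
  proof (intro equalityI subsetI)
    fix v assume "v \<in> U"
    then obtain W where W: "\<forall>i\<in>I. open (W i)" "v \<in> Pi\<^sub>E I W" "Pi\<^sub>E I W \<subseteq> U"
      using U unfolding openin_product_topology_alt by (metis open_openin)
    have "\<exists>q. q \<in> \<rat> \<times> \<rat> \<and> v i \<in> {fst q<..<snd q} \<and> {fst q<..<snd q} \<subseteq> W i" if "i \<in> I" for i
    proof -
      have "open (W i)" "v i \<in> W i" using W that by auto
      then obtain e where e: "e > 0" "\<forall>y. dist y (v i) < e \<longrightarrow> y \<in> W i"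
        unfolding open_dist by blast
      obtain a b where ab: "a \<in> \<rat>" "v i - e < a" "a < v i" "b \<in> \<rat>" "v i < b" "b < v i + e"
        using Rats_dense_in_real[of "v i - e" "v i"] Rats_dense_in_real[of "v i" "v i + e"] e by auto
      then have "{a<..<b} \<subseteq> W i"
        using e by (auto simp: dist_real_def)
      with ab show ?thesis by (intro exI[of _ "(a, b)"]) auto
    qed
    then obtain q where q: "\<And>i. i \<in> I \<Longrightarrow>
        q i \<in> \<rat> \<times> \<rat> \<and> v i \<in> {fst (q i)<..<snd (q i)} \<and> {fst (q i)<..<snd (q i)} \<subseteq> W i"
      by metis
    have "box (restrict q I) \<subseteq> Pi\<^sub>E I W"
      unfolding box_def using q by (intro PiE_mono) auto
    with q W(3) have "restrict q I \<in> J" by (auto simp: J_def)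
    moreover have "v \<in> box (restrict q I)"
      using q W(2) by (auto simp: box_def PiE_iff)
    ultimately show "v \<in> (\<Union>p\<in>J. box p)" by blast
  qed (auto simp: J_def)
  ultimately show ?thesis by auto
qed

lemma continuous_map_imp_vec_borel_measurable:
  assumes "finite I" and h: "continuous_map (powertop_real I) euclideanreal h"
  shows "h \<in> borel_measurable (vec_borel I)"
proof (rule borel_measurableI)
  fix S :: "real set" assume "open S"
  then have "openin (powertop_real I) {v \<in> topspace (powertop_real I). h v \<in> S}"
    using h by (intro openin_continuous_map_preimage) auto
  then have "{v \<in> topspace (powertop_real I). h v \<in> S} \<in> sets (vec_borel I)"
    by (rule openin_powertop_real_imp_sets[OF assms(1)])
  also have "{v \<in> topspace (powertop_real I). h v \<in> S} = h -` S \<inter> space (vec_borel I)"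
    by (auto simp: space_PiM)
  finally show "h -` S \<inter> space (vec_borel I) \<in> sets (vec_borel I)" .
qed

section \<open>The l1 distance and Lipschitz minorants\<close>

lemma continuous_map_powertop_real_proj:
  "i \<in> I \<Longrightarrow> continuous_map (powertop_real I) euclideanreal (\<lambda>v. v i)"
  by (rule continuous_map_product_projection)

text \<open>Together with \<open>l1_ball_subset_openin\<close>: the l1 distance induces the topology
  of a finite power, so that bounded Lipschitz functions for this distance are legitimate test
  functions.\<close>

lemma openin_l1_ball:
  fixes v :: "'i \<Rightarrow> real"
  assumes "finite I"
  shows "openin (powertop_real I) {w \<in> topspace (powertop_real I). (\<Sum>i\<in>I. \<bar>v i - w i\<bar>) < r}"
proof -
  have "continuous_map (powertop_real I) euclideanreal (\<lambda>w. \<Sum>i\<in>I. \<bar>v i - w i\<bar>)"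
    using assms
    by (intro continuous_map_sum continuous_map_real_abs continuous_map_diff
        continuous_map_powertop_real_proj) auto
  then have "openin (powertop_real I)
      {w \<in> topspace (powertop_real I). (\<Sum>i\<in>I. \<bar>v i - w i\<bar>) \<in> {..<r}}"
    by (rule openin_continuous_map_preimage) auto
  then show ?thesis by simp
qed

lemma l1_ball_subset_openin:
  fixes v :: "'i \<Rightarrow> real"
  assumes "finite I" and U: "openin (powertop_real I) U" "v \<in> U"
  obtains r where "r > 0"
    "\<And>w. w \<in> topspace (powertop_real I) \<Longrightarrow> (\<Sum>i\<in>I. \<bar>v i - w i\<bar>) < r \<Longrightarrow> w \<in> U"
proof -
  obtain W where W: "\<forall>i\<in>I. open (W i)" "v \<in> Pi\<^sub>E I W" "Pi\<^sub>E I W \<subseteq> U"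
    using U unfolding openin_product_topology_alt by (metis open_openin)
  have "\<exists>e>0. \<forall>y. dist y (v i) < e \<longrightarrow> y \<in> W i" if "i \<in> I" for i
    using W that by (auto simp: open_dist)
  then obtain e where e: "\<And>i. i \<in> I \<Longrightarrow> e i > 0 \<and> (\<forall>y. dist y (v i) < e i \<longrightarrow> y \<in> W i)"
    by metis
  define r where "r = Min (insert 1 (e ` I))"
  have r: "r > 0" "\<And>i. i \<in> I \<Longrightarrow> r \<le> e i"
    using e assms(1) by (auto simp: r_def)
  show thesis
  proof
    show "r > 0" by fact
    fix w :: "'i \<Rightarrow> real"
    assume w: "w \<in> topspace (powertop_real I)" "(\<Sum>i\<in>I. \<bar>v i - w i\<bar>) < r"
    have "w i \<in> W i" if "i \<in> I" for i
    proof -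
      have "\<bar>v i - w i\<bar> \<le> (\<Sum>i\<in>I. \<bar>v i - w i\<bar>)"
        using assms(1) that by (intro member_le_sum) auto
      with w r that have "dist (w i) (v i) < e i"
        by (fastforce simp: dist_real_def abs_minus_commute)
      with e that show ?thesis by auto
    qed
    with w(1) have "w \<in> Pi\<^sub>E I W" by (simp add: PiE_iff)
    with W(3) show "w \<in> U" by blast
  qed
qed

text \<open>The Lipschitz minorants \<open>L n v = inf\<^sub>y (h y + n |v - y|\<^sub>1)\<close> increase to \<open>h\<close> at every
  continuity point of \<open>h\<close>.\<close>

lemma weakly_converges_lower_bound:
  fixes I :: "'i set" and h :: "('i \<Rightarrow> real) \<Rightarrow> real"
  assumes fin: "finite I"
    and conv: "weakly_converges (powertop_real I) \<mu> \<nu> F"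
    and \<mu>: "\<forall>\<^sub>F x in F. prob_space (\<mu> x) \<and> sets (\<mu> x) = sets (vec_borel I)"
    and \<nu>: "prob_space \<nu>" "sets \<nu> = sets (vec_borel I)"
    and h: "h \<in> borel_measurable (vec_borel I)" "\<And>v. v \<in> I \<rightarrow>\<^sub>E UNIV \<Longrightarrow> \<bar>h v\<bar> \<le> B"
    and cont: "AE v in \<nu>. topcontinuous_at (powertop_real I) euclideanreal h v"
    and e: "e > 0"
  shows "\<forall>\<^sub>F x in F. (\<integral>v. h v \<partial>\<mu> x) > (\<integral>v. h v \<partial>\<nu>) - e"
proof -
  interpret \<nu>: prob_space \<nu> by fact
  define E where "E = (I \<rightarrow>\<^sub>E (UNIV :: real set))"
  have topE: "topspace (powertop_real I) = E" by (simp add: E_def)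
  have spE: "space N = E" if "sets N = sets (vec_borel I)" for N
    using sets_eq_imp_space_eq[OF that] by (simp add: space_PiM E_def)
  have ne: "E \<noteq> {}" by (simp add: E_def PiE_eq_empty_iff)
  define d where "d = (\<lambda>v w :: 'i \<Rightarrow> real. \<Sum>i\<in>I. \<bar>v i - w i\<bar>)"
  have d0: "d v w \<ge> 0" for v w unfolding d_def by (simp add: sum_nonneg)
  have d_self: "d v v = 0" for v unfolding d_def by simp
  have d_tri: "d u w \<le> d u v + d v w" for u v w
    unfolding d_def sum.distrib[symmetric] by (intro sum_mono) auto
  have d_sym: "d u w = d w u" for u w
    unfolding d_def by (simp add: abs_minus_commute)
  define L where "L = (\<lambda>n v. INF y\<in>E. h y + real n * d v y)"
  have ge: "- B \<le> h y + real n * d v y" if "y \<in> E" for n v y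
    using h(2)[of y] that d0[of v y] by (auto simp: E_def intro: add_increasing2)
  have bdd: "bdd_below ((\<lambda>y. h y + real n * d v y) ` E)" for n v
    using ge by (intro bdd_belowI2) auto
  have L_ge: "m \<le> L n v" if "\<And>y. y \<in> E \<Longrightarrow> m \<le> h y + real n * d v y" for m n v
    unfolding L_def using that ne by (intro cINF_greatest) auto
  have L_le: "L n v \<le> h y + real n * d v y" if "y \<in> E" for n v y
    unfolding L_def using bdd that by (rule cINF_lower)
  have L_le_h: "L n v \<le> h v" if "v \<in> E" for n v
    using L_le[OF that, of n v] by (simp add: d_self)
  have L_bound: "\<bar>L n v\<bar> \<le> B" if "v \<in> E" for n v
    using L_le_h[OF that, of n] L_ge[of "-B" n v, OF ge] h(2)[of v] that
    by (auto simp: E_def abs_le_iff)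
  have Lip1: "L n v - real n * d v w \<le> L n w" for n v w
  proof (rule L_ge)
    fix y assume y: "y \<in> E"
    have "L n v \<le> h y + real n * d v y" using L_le[OF y] .
    also have "\<dots> \<le> h y + real n * (d v w + d w y)"
      using d_tri[of v y w] by (simp add: mult_left_mono)
    finally show "L n v - real n * d v w \<le> h y + real n * d w y" by (simp add: algebra_simps)
  qed
  have Lip: "\<bar>L n w - L n v\<bar> \<le> real n * d v w" for n v w
    using Lip1[of n v w] Lip1[of n w v] by (simp add: d_sym abs_le_iff)
  have L_cont: "continuous_map (powertop_real I) euclideanreal (L n)" for n
    unfolding continuous_map_eq_topcontinuous_at topcontinuous_at_def
  proof (intro ballI conjI allI impI)
    fix v V assume v: "v \<in> topspace (powertop_real I)"
      and V: "openin euclideanreal V \<and> L n v \<in> V"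
    then obtain r where r: "r > 0" "\<And>y. dist y (L n v) < r \<Longrightarrow> y \<in> V"
      by (metis open_dist open_openin)
    \<comment> \<open>Dividing by \<open>Suc n\<close> keeps the radius positive at
      \<open>n = 0\<close>, where \<open>r / 0 = 0\<close> would leave an empty ball.\<close>
    define U where "U = {w \<in> topspace (powertop_real I). d v w < r / real (Suc n)}"
    have "openin (powertop_real I) U"
      unfolding U_def d_def by (rule openin_l1_ball[OF fin])
    moreover have "v \<in> U" using v r by (simp add: U_def d_self)
    moreover have "L n w \<in> V" if "w \<in> U" for w
    proof (rule r)
      have "dist (L n w) (L n v) \<le> real n * d v w" using Lip by (simp add: dist_real_def)
      also have "\<dots> \<le> real (Suc n) * d v w" using d0 by (simp add: mult_right_mono)
      also have "\<dots> < r" using that by (simp add: U_def field_simps)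
      finally show "dist (L n w) (L n v) < r" .
    qed
    ultimately show "\<exists>U. openin (powertop_real I) U \<and> v \<in> U \<and> (\<forall>w\<in>U. L n w \<in> V)" by blast
  qed (auto simp: topE)
  have L_meas: "L n \<in> borel_measurable N" if "sets N = sets (vec_borel I)" for n N
    using continuous_map_imp_vec_borel_measurable[OF fin L_cont, of n] measurable_cong_sets[OF that refl]
    by blast
  have h_meas: "h \<in> borel_measurable N" if "sets N = sets (vec_borel I)" for N
    using h(1) measurable_cong_sets[OF that refl] by blast
  have L_conv: "(\<lambda>n. L n v) \<longlonglongrightarrow> h v"
    if v: "v \<in> E" and c: "topcontinuous_at (powertop_real I) euclideanreal h v" for v
  proof (rule LIMSEQ_I)
    fix r :: real assume r: "r > 0"
    obtain U where U: "openin (powertop_real I) U" "v \<in> U" "\<forall>w\<in>U. h w \<in> ball (h v) (r/2)"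
      using c r unfolding topcontinuous_at_def
      by (metis centre_in_ball half_gt_zero open_ball open_openin)
    obtain \<delta> where \<delta>: "\<delta> > 0" "\<And>w. w \<in> E \<Longrightarrow> d v w < \<delta> \<Longrightarrow> w \<in> U"
      using l1_ball_subset_openin[OF fin U(1,2)] unfolding topE d_def by metis
    \<comment> \<open>The values of \<open>h\<close> differ by at most \<open>2 * B\<close>. Once
      the slope times \<open>\<delta>\<close> reaches this, points outside the ball of radius
      \<open>\<delta>\<close> cannot pull the infimum below \<open>h v\<close>, and inside it
      \<open>h\<close> stays within \<open>r / 2\<close> of \<open>h v\<close>.\<close>
    obtain n0 :: nat where n0: "real n0 > 2 * B / \<delta>" using reals_Archimedean2 by blast
    have "\<bar>L n v - h v\<bar> < r" if "n \<ge> n0" for n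
    proof -
      have "h v - r/2 \<le> L n v"
      proof (rule L_ge)
        fix y assume y: "y \<in> E"
        show "h v - r/2 \<le> h y + real n * d v y"
        proof (cases "d v y < \<delta>")
          case True
          then have "\<bar>h v - h y\<bar> < r/2" using \<delta>(2)[OF y] U(3) by (auto simp: dist_real_def)
          moreover have "real n * d v y \<ge> 0" using d0 by simp
          ultimately show ?thesis by linarith
        next
          case False
          have "2 * B \<le> real n0 * \<delta>" using n0 \<delta>(1) by (simp add: field_simps)
          also have "\<dots> \<le> real n * d v y" using False that \<delta>(1) by (intro mult_mono) auto
          finally show ?thesis using h(2)[of v] h(2)[of y] v y r by (auto simp: E_def)
        qed
      qed
      with L_le_h[OF v, of n] r show ?thesis by (auto simp: abs_less_iff)
    qed
    then show "\<exists>no. \<forall>n\<ge>no. norm (L n v - h v) < r" by auto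
  qed
  have "(\<lambda>n. \<integral>v. L n v \<partial>\<nu>) \<longlonglongrightarrow> (\<integral>v. h v \<partial>\<nu>)"
  proof (rule integral_dominated_convergence[where w = "\<lambda>_. B"])
    show "AE v in \<nu>. (\<lambda>n. L n v) \<longlonglongrightarrow> h v"
      using cont AE_space by eventually_elim (auto simp: spE[OF \<nu>(2)] intro: L_conv)
    show "AE v in \<nu>. norm (L n v) \<le> B" for n
      using AE_space by eventually_elim (auto simp: spE[OF \<nu>(2)] intro: L_bound)
  qed (use h_meas[OF \<nu>(2)] L_meas[OF \<nu>(2)] in auto)
  then have "\<forall>\<^sub>F n in sequentially. (\<integral>v. h v \<partial>\<nu>) - e < (\<integral>v. L n v \<partial>\<nu>)"
    using e by (intro order_tendstoD) auto
  \<comment> \<open>The index \<open>n\<close> is fixed through the limit law alone; weak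
    convergence is then applied to the single bounded continuous function
    \<open>L n\<close>.\<close>
  then obtain n where n: "(\<integral>v. h v \<partial>\<nu>) - e < (\<integral>v. L n v \<partial>\<nu>)"
    by (auto simp: eventually_sequentially)
  have "bounded (L n ` topspace (powertop_real I))"
    unfolding bounded_iff topE by (intro exI[of _ B]) (use L_bound in auto)
  then have "((\<lambda>x. \<integral>v. L n v \<partial>\<mu> x) \<longlongrightarrow> (\<integral>v. L n v \<partial>\<nu>)) F"
    using conv L_cont unfolding weakly_converges_def by blast
  then have "\<forall>\<^sub>F x in F. (\<integral>v. h v \<partial>\<nu>) - e < (\<integral>v. L n v \<partial>\<mu> x)"
    using n by (rule order_tendstoD)
  with \<mu> show ?thesis
  proof eventually_elim
    case (elim x)
    interpret prob_space "\<mu> x" using elim by simp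
    have s: "sets (\<mu> x) = sets (vec_borel I)" using elim by simp
    have "integrable (\<mu> x) (L n)" "integrable (\<mu> x) h"
      by (rule integrable_const_bound[where B = B];
          use L_bound h(2) h_meas[OF s] L_meas[OF s] in \<open>auto simp: spE[OF s] E_def\<close>)+
    then have "(\<integral>v. L n v \<partial>\<mu> x) \<le> (\<integral>v. h v \<partial>\<mu> x)"
      using L_le_h by (intro integral_mono) (auto simp: spE[OF s])
    with elim show ?case by linarith
  qed
qed

lemma topcontinuous_at_real_minus:
  assumes "topcontinuous_at T euclideanreal h v"
  shows "topcontinuous_at T euclideanreal (\<lambda>v. - h v :: real) v"
  using assms unfolding topcontinuous_at_atin
  by (auto simp: limitin_canonical_iff intro: tendsto_minus)

text \<open>Lower bounds for \<open>h\<close> and for \<open>- h\<close> squeeze the integrals. The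
  discontinuities of \<open>h\<close> need only be null for the limit law, which is what admits
  indicators as integrands.\<close>

lemma weakly_converges_integral:
  fixes I :: "'i set" and h :: "('i \<Rightarrow> real) \<Rightarrow> real"
  assumes fin: "finite I"
    and conv: "weakly_converges (powertop_real I) \<mu> \<nu> F"
    and \<mu>: "\<forall>\<^sub>F x in F. prob_space (\<mu> x) \<and> sets (\<mu> x) = sets (vec_borel I)"
    and \<nu>: "prob_space \<nu>" "sets \<nu> = sets (vec_borel I)"
    and h: "h \<in> borel_measurable (vec_borel I)" "\<And>v. v \<in> I \<rightarrow>\<^sub>E UNIV \<Longrightarrow> \<bar>h v\<bar> \<le> B"
    and cont: "AE v in \<nu>. topcontinuous_at (powertop_real I) euclideanreal h v"
  shows "((\<lambda>x. \<integral>v. h v \<partial>\<mu> x) \<longlongrightarrow> (\<integral>v. h v \<partial>\<nu>)) F"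
proof (rule tendstoI)
  fix e :: real assume e: "e > 0"
  have "\<forall>\<^sub>F x in F. (\<integral>v. h v \<partial>\<mu> x) > (\<integral>v. h v \<partial>\<nu>) - e"
    by (rule weakly_converges_lower_bound[OF assms e])
  moreover have "\<forall>\<^sub>F x in F. (\<integral>v. - h v \<partial>\<mu> x) > (\<integral>v. - h v \<partial>\<nu>) - e"
    using cont h
    by (intro weakly_converges_lower_bound[OF fin conv \<mu> \<nu> _ _ _ e, where B = B])
      (auto intro: AE_mp topcontinuous_at_real_minus)
  ultimately show "\<forall>\<^sub>F x in F. dist (\<integral>v. h v \<partial>\<mu> x) (\<integral>v. h v \<partial>\<nu>) < e"
    by eventually_elim (simp add: dist_real_def abs_less_iff)
qed

section \<open>Cluster functionals\<close>

text \<open>The argument \<open>z\<close> is a total sequence rather than an element of the product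
  space, so shifting a block or changing its length is a substitution, free of
  \<open>restrict\<close>.\<close>

definition cluster_exceeds ::
    "(nat \<Rightarrow> (nat \<Rightarrow> real) \<Rightarrow> real) \<Rightarrow> nat \<Rightarrow> (nat \<Rightarrow> real) \<Rightarrow> bool" where
  "cluster_exceeds c l z \<longleftrightarrow> c l (\<lambda>i\<in>{1..l}. pos_part (z i - 1)) > 1"

lemma condition_C_0:
  assumes "condition_C N \<epsilon> g"
  shows "g 0 (restrict x {1..0}) = 0"
proof -
  have "\<forall>x \<in> {1..0} \<rightarrow>\<^sub>E UNIV. g 0 x = 0"
    using assms unfolding condition_C_def by (elim conjE)
  then show ?thesis by (rule bspec) (rule restrict_PiE_iff[THEN iffD2], simp)
qed

lemma condition_C_small:
  assumes "condition_C N \<epsilon> g" "1 \<le> l" "x \<in> {1..l} \<rightarrow>\<^sub>E UNIV" "\<And>i. i \<in> {1..l} \<Longrightarrow> \<bar>x i\<bar> \<le> \<epsilon>"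
  shows "g l x = 0"
proof -
  have "\<forall>l\<ge>1. \<forall>x \<in> {1..l} \<rightarrow>\<^sub>E UNIV. (\<forall>i\<in>{1..l}. \<bar>x i\<bar> \<le> \<epsilon>) \<longrightarrow> g l x = 0"
    using assms(1) unfolding condition_C_def by (elim conjE)
  with assms(2-4) show ?thesis by simp
qed

lemma condition_C_shift:
  assumes "condition_C N \<epsilon> g" "1 \<le> j1" "j1 \<le> j2" "j2 \<le> l" "x \<in> {1..l} \<rightarrow>\<^sub>E UNIV"
    and "\<And>i. i \<in> {1..j1 - 1} \<union> {j2 + 1..l} \<Longrightarrow> \<bar>x i\<bar> \<le> \<epsilon>"
  shows "g l x = g (j2 - j1 + 1) (\<lambda>i\<in>{1..j2 - j1 + 1}. x (j1 + i - 1))"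
proof -
  have "\<forall>l j1 j2. 1 \<le> j1 \<and> j1 \<le> j2 \<and> j2 \<le> l \<longrightarrow>
        (\<forall>x \<in> {1..l} \<rightarrow>\<^sub>E UNIV. (\<forall>i \<in> {1..j1 - 1} \<union> {j2 + 1..l}. \<bar>x i\<bar> \<le> \<epsilon>) \<longrightarrow>
           g l x = g (j2 - j1 + 1) (\<lambda>i\<in>{1..j2 - j1 + 1}. x (j1 + i - 1)))"
    using assms(1) unfolding condition_C_def by (elim conjE)
  with assms(2-6) show ?thesis by simp
qed

lemma condition_C_prefix:
  assumes "condition_C N \<epsilon> g" "1 \<le> j" "j \<le> l" "x \<in> {1..l} \<rightarrow>\<^sub>E UNIV"
    and small: "\<And>i. j < i \<Longrightarrow> i \<le> l \<Longrightarrow> \<bar>x i\<bar> \<le> \<epsilon>"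
  shows "g l x = g j (restrict x {1..j})"
proof -
  have "g l x = g (j - 1 + 1) (\<lambda>i\<in>{1..j - 1 + 1}. x (1 + i - 1))"
    using small by (intro condition_C_shift[OF assms(1) _ assms(2-4)]) auto
  then show ?thesis using assms(2) by simp
qed

text \<open>Shift rule with \<open>j1 = 2\<close> and \<open>j2 = l\<close>. It needs a nonempty
  remainder, so \<open>l = 1\<close> is separate: there both sides are 0, the left by the smallness
  clause and the right by the convention for length 0.\<close>

lemma condition_C_tl:
  assumes C: "condition_C N \<epsilon> g" and "1 \<le> l" "x \<in> {1..l} \<rightarrow>\<^sub>E UNIV" "\<bar>x 1\<bar> \<le> \<epsilon>"
  shows "g l x = g (l - 1) (\<lambda>i\<in>{1..l - 1}. x (i + 1))"
proof (cases "l = 1")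
  case True
  have "g l x = 0" using True assms(4) by (intro condition_C_small[OF assms(1-3)]) auto
  moreover have "g 0 (\<lambda>i\<in>{1..0}. x (i + 1)) = 0" by (rule condition_C_0[OF C])
  ultimately show ?thesis using True by simp
next
  case False
  then have l: "2 \<le> l" using assms(2) by simp
  have "g l x = g (l - 2 + 1) (\<lambda>i\<in>{1..l - 2 + 1}. x (2 + i - 1))"
    using assms(4) l by (intro condition_C_shift[OF C _ l _ assms(3)]) (auto simp: le_Suc_eq)
  moreover have "l - 2 + 1 = l - 1" using l by simp
  moreover have "2 + i - 1 = i + 1" for i :: nat by simp
  ultimately show ?thesis by (simp only:)
qed

lemma not_cluster_exceeds_0:
  assumes "condition_C N \<epsilon> c"
  shows "\<not> cluster_exceeds c 0 z"
proof -
  have "c 0 (\<lambda>i\<in>{1..0}. pos_part (z i - 1)) = 0" by (rule condition_C_0[OF assms])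
  then show ?thesis by (simp add: cluster_exceeds_def)
qed

text \<open>Entries at most 1 have excess 0 over the level 1, so (C_0) removes them. A one-sided
  bound suffices, because very negative entries have no excess either.\<close>

lemma cluster_exceeds_prefix:
  assumes "condition_C N 0 c" "1 \<le> j" "j \<le> l"
    and "\<And>i. j < i \<Longrightarrow> i \<le> l \<Longrightarrow> z i \<le> 1"
  shows "cluster_exceeds c l z \<longleftrightarrow> cluster_exceeds c j z"
proof -
  have "c l (\<lambda>i\<in>{1..l}. pos_part (z i - 1))
      = c j (restrict (\<lambda>i\<in>{1..l}. pos_part (z i - 1)) {1..j})"
    using assms by (intro condition_C_prefix[OF assms(1-3)]) (auto simp: pos_part_def)
  also have "restrict (\<lambda>i\<in>{1..l}. pos_part (z i - 1)) {1..j} = (\<lambda>i\<in>{1..j}. pos_part (z i - 1))"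
    using assms(3) by (auto simp: fun_eq_iff)
  finally show ?thesis by (simp only: cluster_exceeds_def)
qed

text \<open>The cancellation behind the telescoping sum: where the first entry does not exceed the
  level, the block that starts with it and the block that starts just after it decide the same
  event.\<close>

lemma cluster_exceeds_tl:
  assumes "condition_C N 0 c" "1 \<le> l" "z 1 \<le> 1"
  shows "cluster_exceeds c l z \<longleftrightarrow> cluster_exceeds c (l - 1) (\<lambda>i. z (i + 1))"
proof -
  have "c l (\<lambda>i\<in>{1..l}. pos_part (z i - 1))
      = c (l - 1) (\<lambda>i\<in>{1..l - 1}. (\<lambda>i\<in>{1..l}. pos_part (z i - 1)) (i + 1))"
    using assms by (intro condition_C_tl[OF assms(1,2)]) (auto simp: pos_part_def)
  also have "(\<lambda>i\<in>{1..l - 1}. (\<lambda>i\<in>{1..l}. pos_part (z i - 1)) (i + 1))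
      = (\<lambda>i\<in>{1..l - 1}. pos_part (z (i + 1) - 1))"
    using assms(2) by (intro restrict_ext) auto
  finally show ?thesis by (simp only: cluster_exceeds_def)
qed

lemma exceedance_indicator_eq: "exceedance_indicator c l z = of_bool (cluster_exceeds c l z)"
  by (simp add: exceedance_indicator_def cluster_exceeds_def)

lemma exceedance_indicator_restrict:
  "exceedance_indicator c l (restrict z {1..l}) = of_bool (cluster_exceeds c l z)"
proof -
  have "(\<lambda>i\<in>{1..l}. pos_part (restrict z {1..l} i - 1)) = (\<lambda>i\<in>{1..l}. pos_part (z i - 1))"
    by (intro restrict_ext) auto
  then show ?thesis by (simp add: exceedance_indicator_def cluster_exceeds_def)
qed

section \<open>Measurability and evaluation at infinite sequences\<close>

lemma pred_cluster_exceeds: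
  assumes "condition_C N \<epsilon> c" and Z: "\<And>i. Z i \<in> borel_measurable M"
  shows "Measurable.pred M (\<lambda>\<omega>. cluster_exceeds c l (\<lambda>i. Z i \<omega>))"
proof (cases "l = 0")
  \<comment> \<open>\<open>condition_C\<close> speaks of measurability for \<open>l \<ge> 1\<close>;
    at length 0 the event is empty.\<close>
  case True
  with not_cluster_exceeds_0[OF assms(1)] show ?thesis by simp
next
  case False
  then have [measurable]: "c l \<in> borel_measurable (vec_borel {1..l})"
    using assms(1) by (auto simp: condition_C_def)
  note [measurable] = Z
  have "(\<lambda>\<omega>. \<lambda>i\<in>{1..l}. pos_part (Z i \<omega> - 1)) \<in> measurable M (vec_borel {1..l})"
    unfolding pos_part_def by (intro measurable_restrict) measurable
  then have [measurable]: "(\<lambda>\<omega>. c l (\<lambda>i\<in>{1..l}. pos_part (Z i \<omega> - 1))) \<in> borel_measurable M"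
    by measurable
  show ?thesis unfolding cluster_exceeds_def by measurable
qed

text \<open>The least cut-off chosen by \<open>eval_seq\<close> may lie below \<open>k\<close>. The
  entries in between are 0 and drop out by (C_0); a cut-off of 0 gives the value 0 on both
  sides.\<close>

lemma eval_seq_eq:
  assumes C: "condition_C N 0 c" and k: "1 \<le> k" "\<And>i. i > k \<Longrightarrow> x i = 0"
  shows "eval_seq c x = c k (restrict x {1..k})"
proof -
  define l where "l = (LEAST l. \<forall>i>l. x i = 0)"
  have ex: "\<exists>l. \<forall>i>l. x i = 0" using k by blast
  then have l: "\<forall>i>l. x i = 0" unfolding l_def by (rule LeastI_ex)
  have "l \<le> k" unfolding l_def by (rule Least_le) (use k in auto)
  have "c k (restrict x {1..k}) = c l (restrict x {1..l})"
  proof (cases "l = 0")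
    case True
    have "c k (restrict x {1..k}) = 0" using l True by (intro condition_C_small[OF C k(1)]) auto
    moreover have "c 0 (restrict x {1..0}) = 0" by (rule condition_C_0[OF C])
    ultimately show ?thesis using True by simp
  next
    case False
    have "c k (restrict x {1..k}) = c l (restrict (restrict x {1..k}) {1..l})"
      using False l \<open>l \<le> k\<close> by (intro condition_C_prefix[OF C]) auto
    also have "restrict (restrict x {1..k}) {1..l} = restrict x {1..l}"
      using \<open>l \<le> k\<close> by (auto simp: fun_eq_iff)
    finally show ?thesis .
  qed
  with ex show ?thesis by (simp add: eval_seq_def l_def Let_def)
qed

lemma eval_seq_gt_1_iff:
  assumes C: "condition_C N 0 c" and k: "1 \<le> k" "\<And>i. i > k \<Longrightarrow> z i \<le> 1"
  shows "eval_seq c (\<lambda>i. pos_part (z i - 1)) > 1 \<longleftrightarrow> cluster_exceeds c k z"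
proof -
  have "eval_seq c (\<lambda>i. pos_part (z i - 1)) = c k (\<lambda>i\<in>{1..k}. pos_part (z i - 1))"
    using k by (intro eval_seq_eq[OF C]) (auto simp: pos_part_def)
  then show ?thesis by (simp add: cluster_exceeds_def)
qed

text \<open>The point is the countable union over \<open>k\<close> on the right, from which
  measurability follows. If infinitely many entries exceed 1, the left side fails through the dummy
  value 0 and the right side for lack of a suitable \<open>k\<close>.\<close>

lemma eval_seq_gt_1_iff_ex:
  assumes C: "condition_C N 0 c"
  shows "eval_seq c (\<lambda>i. pos_part (z i - 1)) > 1
    \<longleftrightarrow> (\<exists>k\<ge>1. (\<forall>i>k. z i \<le> 1) \<and> cluster_exceeds c k z)" (is "?lhs \<longleftrightarrow> ?rhs")
proof
  assume L: ?lhs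
  have "\<exists>l. \<forall>i>l. pos_part (z i - 1) = 0"
  proof (rule ccontr)
    assume "\<nexists>l. \<forall>i>l. pos_part (z i - 1) = 0"
    then have "eval_seq c (\<lambda>i. pos_part (z i - 1)) = 0" unfolding eval_seq_def by (rule if_not_P)
    with L show False by simp
  qed
  then obtain l where l: "\<forall>i>l. pos_part (z i - 1) = 0" by blast
  \<comment> \<open>Block lengths start at 1, hence \<open>max l 1\<close> to cover a possible
    \<open>l = 0\<close>.\<close>
  have z: "z i \<le> 1" if "i > max l 1" for i
  proof -
    have "pos_part (z i - 1) = 0" using l that by simp
    then show ?thesis by (simp add: pos_part_def max_def split: if_splits)
  qed
  have "cluster_exceeds c (max l 1) z"
    by (rule iffD1[OF eval_seq_gt_1_iff[OF C _ z] L]) auto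
  then show ?rhs using z by (intro exI[of _ "max l 1"]) simp
next
  assume ?rhs
  then obtain k where "k \<ge> 1" "\<forall>i>k. z i \<le> 1" "cluster_exceeds c k z" by blast
  then show ?lhs by (intro iffD2[OF eval_seq_gt_1_iff[OF C, of k]]) auto
qed

lemma pred_eval_seq_gt_1:
  assumes C: "condition_C N 0 c" and Z[measurable]: "\<And>i. Z i \<in> borel_measurable M"
  shows "Measurable.pred M (\<lambda>\<omega>. eval_seq c (\<lambda>i. pos_part (Z i \<omega> - 1)) > 1)"
proof -
  have [measurable]: "Measurable.pred M (\<lambda>\<omega>. cluster_exceeds c k (\<lambda>i. Z i \<omega>))" for k
    by (rule pred_cluster_exceeds[OF C Z])
  show ?thesis unfolding eval_seq_gt_1_iff_ex[OF C] by measurable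
qed

section \<open>Comparison of probabilities and invariance under time shifts\<close>

lemma (in prob_space) abs_prob_diff_le:
  assumes "{\<omega> \<in> space M. A \<omega>} \<in> events" "{\<omega> \<in> space M. B \<omega>} \<in> events"
    "{\<omega> \<in> space M. C \<omega>} \<in> events"
    and "\<And>\<omega>. \<omega> \<in> space M \<Longrightarrow> \<not> C \<omega> \<Longrightarrow> A \<omega> \<longleftrightarrow> B \<omega>"
  shows "\<bar>\<P>(\<omega> in M. A \<omega>) - \<P>(\<omega> in M. B \<omega>)\<bar> \<le> \<P>(\<omega> in M. C \<omega>)"
proof -
  have *: "\<P>(\<omega> in M. A \<omega>) \<le> \<P>(\<omega> in M. B \<omega>) + \<P>(\<omega> in M. C \<omega>)"
    if "{\<omega> \<in> space M. A \<omega>} \<in> events" "{\<omega> \<in> space M. B \<omega>} \<in> events"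
      "\<And>\<omega>. \<omega> \<in> space M \<Longrightarrow> \<not> C \<omega> \<Longrightarrow> A \<omega> \<longleftrightarrow> B \<omega>" for A B
  proof -
    have "\<P>(\<omega> in M. A \<omega>) \<le> prob ({\<omega> \<in> space M. B \<omega>} \<union> {\<omega> \<in> space M. C \<omega>})"
    proof (intro finite_measure_mono subsetI)
      fix \<omega> assume "\<omega> \<in> {\<omega> \<in> space M. A \<omega>}"
      then show "\<omega> \<in> {\<omega> \<in> space M. B \<omega>} \<union> {\<omega> \<in> space M. C \<omega>}"
        using that(3)[of \<omega>] by blast
    qed (intro sets.Un that assms(3))
    also have "\<dots> \<le> \<P>(\<omega> in M. B \<omega>) + \<P>(\<omega> in M. C \<omega>)"
      by (intro measure_Un_le that assms(3))
    finally show ?thesis .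
  qed
  have "\<P>(\<omega> in M. A \<omega>) \<le> \<P>(\<omega> in M. B \<omega>) + \<P>(\<omega> in M. C \<omega>)"
    by (rule *[OF assms(1,2,4)])
  moreover have "\<P>(\<omega> in M. B \<omega>) \<le> \<P>(\<omega> in M. A \<omega>) + \<P>(\<omega> in M. C \<omega>)"
    by (rule *[OF assms(2,1) assms(4)[symmetric]])
  ultimately show ?thesis by linarith
qed

text \<open>Stationarity is an identity of laws on the path space, so both events are written as
  preimages of one measurable set \<open>S\<close> of paths, under the shifted and the unshifted
  path map.\<close>

lemma stationary_prob_cluster_exceeds:
  assumes X: "strictly_stationary M X" and C: "condition_C N \<epsilon> c"
  shows "\<P>(\<omega> in M. cluster_exceeds c l (\<lambda>i. X (int i + h) \<omega> / x))
    = \<P>(\<omega> in M. cluster_exceeds c l (\<lambda>i. X (int i) \<omega> / x))"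
proof -
  have m[measurable]: "\<And>t. X t \<in> borel_measurable M" using X by (simp add: strictly_stationary_def)
  define S where "S = {v \<in> space (vec_borel UNIV). cluster_exceeds c l (\<lambda>i. v (int i) / x)}"
  have S: "S \<in> sets (vec_borel UNIV)"
    unfolding S_def using pred_cluster_exceeds[OF C, of "\<lambda>i v. v (int i) / x" "vec_borel UNIV"] by simp
  have shift: "measure (distr M (vec_borel UNIV) (\<lambda>\<omega> t. X (t + h) \<omega>)) S
      = \<P>(\<omega> in M. cluster_exceeds c l (\<lambda>i. X (int i + h) \<omega> / x))" for h
  proof -
    have "(\<lambda>\<omega> t. X (t + h) \<omega>) \<in> measurable M (vec_borel UNIV)"
      by (rule measurable_PiM_single') auto
    moreover have "(\<lambda>\<omega> t. X (t + h) \<omega>) -` S \<inter> space M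
        = {\<omega> \<in> space M. cluster_exceeds c l (\<lambda>i. X (int i + h) \<omega> / x)}"
      by (auto simp: S_def space_PiM)
    ultimately show ?thesis using S by (simp add: measure_distr)
  qed
  have "distr M (vec_borel UNIV) (\<lambda>\<omega> t. X (t + h) \<omega>) = distr M (vec_borel UNIV) (\<lambda>\<omega> t. X (t + 0) \<omega>)"
    using X unfolding strictly_stationary_def by simp
  with shift[of h] shift[of 0] show ?thesis by simp
qed

section \<open>Telescoping\<close>

lemma (in prob_space) telescope_step:
  assumes X: "strictly_stationary M X" and C: "condition_C N 0 c" and "x > 0" "1 \<le> m"
  shows "\<P>(\<omega> in M. cluster_exceeds c m (\<lambda>i. X (int i) \<omega> / x))
      - \<P>(\<omega> in M. cluster_exceeds c (m - 1) (\<lambda>i. X (int i) \<omega> / x))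
    = \<P>(\<omega> in M. \<bar>X 0 \<omega>\<bar> > x \<and> cluster_exceeds c m (\<lambda>i. X (int i - 1) \<omega> / x))
      - \<P>(\<omega> in M. \<bar>X 0 \<omega>\<bar> > x \<and> cluster_exceeds c (m - 1) (\<lambda>i. X (int i) \<omega> / x))"
proof -
  have X_meas[measurable]: "X t \<in> borel_measurable M" for t
    using X by (simp add: strictly_stationary_def)
  have [measurable]: "Measurable.pred M (\<lambda>\<omega>. cluster_exceeds c l (\<lambda>i. X (int i + h) \<omega> / x))" for l h
    by (intro pred_cluster_exceeds[OF C]) measurable
  have split: "\<P>(\<omega> in M. A \<omega>) = \<P>(\<omega> in M. \<bar>X 0 \<omega>\<bar> > x \<and> A \<omega>) + \<P>(\<omega> in M. \<not> \<bar>X 0 \<omega>\<bar> > x \<and> A \<omega>)"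
    if [measurable]: "Measurable.pred M A" for A
    by (subst finite_measure_Union[symmetric]) (auto intro!: arg_cong[where f = prob])
  have "cluster_exceeds c m (\<lambda>i. X (int i - 1) \<omega> / x) \<longleftrightarrow> cluster_exceeds c (m - 1) (\<lambda>i. X (int i) \<omega> / x)"
    if "\<not> \<bar>X 0 \<omega>\<bar> > x" for \<omega>
    using cluster_exceeds_tl[OF C \<open>1 \<le> m\<close>, of "\<lambda>i. X (int i - 1) \<omega> / x"] that \<open>x > 0\<close> by simp
  then have "{\<omega> \<in> space M. \<not> \<bar>X 0 \<omega>\<bar> > x \<and> cluster_exceeds c m (\<lambda>i. X (int i - 1) \<omega> / x)}
      = {\<omega> \<in> space M. \<not> \<bar>X 0 \<omega>\<bar> > x \<and> cluster_exceeds c (m - 1) (\<lambda>i. X (int i) \<omega> / x)}"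
    by blast
  moreover have "\<P>(\<omega> in M. cluster_exceeds c m (\<lambda>i. X (int i) \<omega> / x))
      = \<P>(\<omega> in M. cluster_exceeds c m (\<lambda>i. X (int i - 1) \<omega> / x))"
    using stationary_prob_cluster_exceeds[OF X C, of m "-1" x] by simp
  moreover have "Measurable.pred M (\<lambda>\<omega>. cluster_exceeds c m (\<lambda>i. X (int i - 1) \<omega> / x))"
    "Measurable.pred M (\<lambda>\<omega>. cluster_exceeds c (m - 1) (\<lambda>i. X (int i) \<omega> / x))"
    by (intro pred_cluster_exceeds[OF C]; measurable)+
  ultimately show ?thesis
    using split[of "\<lambda>\<omega>. cluster_exceeds c m (\<lambda>i. X (int i - 1) \<omega> / x)"]
      split[of "\<lambda>\<omega>. cluster_exceeds c (m - 1) (\<lambda>i. X (int i) \<omega> / x)"]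
    by simp
qed

text \<open>Here \<open>s\<close> is the time of the first entry, so that entry \<open>i\<close>
  sits at time \<open>s + i - 1\<close>, and \<open>J\<close> contains the times of the entries cut
  off. Unless one of the values at times in \<open>J\<close> exceeds \<open>x\<close> in modulus,
  the shorter block decides the same event.\<close>

lemma (in prob_space) cond_prob_truncate_cluster:
  assumes X: "\<And>t. X t \<in> borel_measurable M" and C: "condition_C N 0 c" and x: "x > 0"
    and "1 \<le> j" "j \<le> m"
    and J: "\<And>i. j < i \<Longrightarrow> i \<le> m \<Longrightarrow> s + int i - 1 \<in> J" and "finite J"
  shows "\<bar>\<P>(\<omega> in M. \<bar>X 0 \<omega>\<bar> > x \<and> cluster_exceeds c m (\<lambda>i. X (s + int i - 1) \<omega> / x))
      - \<P>(\<omega> in M. \<bar>X 0 \<omega>\<bar> > x \<and> cluster_exceeds c j (\<lambda>i. X (s + int i - 1) \<omega> / x))\<bar>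
    \<le> \<P>(\<omega> in M. \<bar>X 0 \<omega>\<bar> > x \<and> (\<exists>t\<in>J. \<bar>X t \<omega>\<bar> > x))"
proof (rule abs_prob_diff_le)
  note [measurable] = X
  have [measurable]: "Measurable.pred M (\<lambda>\<omega>. cluster_exceeds c l (\<lambda>i. X (s + int i - 1) \<omega> / x))" for l
    by (intro pred_cluster_exceeds[OF C]) measurable
  have [measurable]: "Measurable.pred M (\<lambda>\<omega>. \<exists>t\<in>J. \<bar>X t \<omega>\<bar> > x)"
    using \<open>finite J\<close> by measurable
  show "{\<omega> \<in> space M. \<bar>X 0 \<omega>\<bar> > x \<and> cluster_exceeds c m (\<lambda>i. X (s + int i - 1) \<omega> / x)} \<in> events"
    "{\<omega> \<in> space M. \<bar>X 0 \<omega>\<bar> > x \<and> cluster_exceeds c j (\<lambda>i. X (s + int i - 1) \<omega> / x)} \<in> events"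
    "{\<omega> \<in> space M. \<bar>X 0 \<omega>\<bar> > x \<and> (\<exists>t\<in>J. \<bar>X t \<omega>\<bar> > x)} \<in> events"
    by measurable
next
  fix \<omega> assume not: "\<not> (\<bar>X 0 \<omega>\<bar> > x \<and> (\<exists>t\<in>J. \<bar>X t \<omega>\<bar> > x))"
  show "(\<bar>X 0 \<omega>\<bar> > x \<and> cluster_exceeds c m (\<lambda>i. X (s + int i - 1) \<omega> / x))
      \<longleftrightarrow> (\<bar>X 0 \<omega>\<bar> > x \<and> cluster_exceeds c j (\<lambda>i. X (s + int i - 1) \<omega> / x))"
  proof (cases "\<bar>X 0 \<omega>\<bar> > x")
    case True
    have "X (s + int i - 1) \<omega> / x \<le> 1" if "j < i" "i \<le> m" for i
    proof -
      have "\<not> \<bar>X (s + int i - 1) \<omega>\<bar> > x" using True not J[OF that] by blast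
      then show ?thesis using x by simp
    qed
    then have "cluster_exceeds c m (\<lambda>i. X (s + int i - 1) \<omega> / x)
        \<longleftrightarrow> cluster_exceeds c j (\<lambda>i. X (s + int i - 1) \<omega> / x)"
      by (intro cluster_exceeds_prefix[OF C assms(4,5)])
    then show ?thesis by simp
  qed simp
qed

text \<open>Of the \<open>n\<close> telescoping differences, each of the first \<open>k\<close>
  misses the target by at most \<open>2 * p\<close> up to the truncation error, since it and the
  target both lie in \<open>[-p, p]\<close>. Each later one is off by at most \<open>2 * T\<close>,
  one truncation to length \<open>k\<close> for each of its two terms. Division by
  \<open>n * p\<close> gives the bound.\<close>

lemma (in prob_space) cluster_prob_approx:
  assumes X: "strictly_stationary M X" and C: "condition_C N 0 c" and x: "x > 0"
    and k: "1 \<le> k" "k \<le> n"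
  defines "p \<equiv> \<P>(\<omega> in M. \<bar>X 0 \<omega>\<bar> > x)"
    and "A \<equiv> \<lambda>s l. \<P>(\<omega> in M. \<bar>X 0 \<omega>\<bar> > x \<and> cluster_exceeds c l (\<lambda>i. X (s + int i - 1) \<omega> / x))"
    and "T \<equiv> \<P>(\<omega> in M. \<bar>X 0 \<omega>\<bar> > x \<and> (\<exists>t\<in>{int k..int n}. \<bar>X t \<omega>\<bar> > x))"
  assumes p: "p > 0"
  shows "\<bar>\<P>(\<omega> in M. cluster_exceeds c n (\<lambda>i. X (int i) \<omega> / x)) / (real n * p) - (A 0 k / p - A 1 k / p)\<bar>
    \<le> 2 * real k / real n + 2 * (T / p)"
proof -
  define \<phi> where "\<phi> = (\<lambda>m. \<P>(\<omega> in M. cluster_exceeds c m (\<lambda>i. X (int i) \<omega> / x)))"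
  \<comment> \<open>The blocks starting at times 0 and 1 end at the same time, so the second is one
    entry shorter.\<close>
  define D where "D = (\<lambda>m. A 0 m - A 1 (m - 1))"
  have X_meas[measurable]: "X t \<in> borel_measurable M" for t
    using X by (simp add: strictly_stationary_def)
  have A: "0 \<le> A s l" "A s l \<le> p" for s l
  proof -
    show "A s l \<le> p" unfolding A_def p_def by (intro finite_measure_mono) auto
  qed (simp add: A_def)
  have T0: "T \<ge> 0" by (simp add: T_def)
  have step: "\<phi> (Suc m) - \<phi> m = D (Suc m)" for m
    using telescope_step[OF X C x, of "Suc m"] by (simp add: \<phi>_def D_def A_def algebra_simps)
  have "\<phi> 0 = 0" using not_cluster_exceeds_0[OF C] by (simp add: \<phi>_def)
  then have \<phi>_sum: "\<phi> m = (\<Sum>i<m. D (Suc i))" for m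
    using step sum_lessThan_telescope[of \<phi> m] by simp
  \<comment> \<open>The split is at \<open>i < k\<close>, not at \<open>Suc i < k\<close>: the block
    that starts at time 1 has length \<open>i\<close>, and truncation to \<open>k\<close> requires
    \<open>k \<le> i\<close>. All entries cut off then lie at times from \<open>k\<close> to
    \<open>n\<close>, the window of \<open>T\<close>.\<close>
  have bound: "\<bar>D (Suc i) - (A 0 k - A 1 k)\<bar> \<le> (if i < k then 2 * p else 0) + 2 * T" if "i < n" for i
  proof (cases "i < k")
    case True
    then show ?thesis using A[of 0 "Suc i"] A[of 1 i] A[of 0 k] A[of 1 k] T0
      by (auto simp: D_def)
  next
    case False
    have "\<bar>A 0 (Suc i) - A 0 k\<bar> \<le> T"
      unfolding A_def T_def using False that k
      by (intro cond_prob_truncate_cluster[OF X_meas C x]) auto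
    moreover have "\<bar>A 1 i - A 1 k\<bar> \<le> T"
      unfolding A_def T_def using False that k
      by (intro cond_prob_truncate_cluster[OF X_meas C x]) auto
    ultimately show ?thesis using False by (auto simp: D_def)
  qed
  have "\<phi> n - real n * (A 0 k - A 1 k) = (\<Sum>i<n. D (Suc i) - (A 0 k - A 1 k))"
    by (simp add: \<phi>_sum sum_subtractf sum.distrib algebra_simps)
  then have "\<bar>\<phi> n - real n * (A 0 k - A 1 k)\<bar> \<le> (\<Sum>i<n. \<bar>D (Suc i) - (A 0 k - A 1 k)\<bar>)"
    by simp
  also have "\<dots> \<le> (\<Sum>i<n. (if i < k then 2 * p else 0) + 2 * T)"
    using bound by (intro sum_mono) auto
  also have "\<dots> = (\<Sum>i\<in>{..<n} \<inter> {i. i < k}. 2 * p) + real n * (2 * T)"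
    by (simp add: sum.distrib sum.If_cases)
  also have "{..<n} \<inter> {i. i < k} = {..<k}" using k by auto
  finally have main: "\<bar>\<phi> n - real n * (A 0 k - A 1 k)\<bar> \<le> real k * (2 * p) + real n * (2 * T)" by simp
  have n: "real n > 0" using k by simp
  have "\<phi> n / (real n * p) - (A 0 k / p - A 1 k / p) = (\<phi> n - real n * (A 0 k - A 1 k)) / (real n * p)"
    using n p by (simp add: field_simps)
  also have "\<bar>\<dots>\<bar> = \<bar>\<phi> n - real n * (A 0 k - A 1 k)\<bar> / (real n * p)"
    using n p by (simp add: abs_divide abs_mult)
  also have "\<dots> \<le> (real k * (2 * p) + real n * (2 * T)) / (real n * p)"
    using main n p by (intro divide_right_mono) auto
  also have "\<dots> = 2 * real k / real n + 2 * (T / p)"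
    using n p by (simp add: field_simps)
  finally show ?thesis by (simp add: \<phi>_def)
qed

section \<open>Limits along the tail process\<close>

lemma integral_distr_reindex:
  fixes r :: "'j \<Rightarrow> 'i" and h :: "('j \<Rightarrow> real) \<Rightarrow> real"
  assumes Z: "\<And>i. Z i \<in> borel_measurable Q"
    and h: "h \<in> borel_measurable (vec_borel J)"
      "h \<circ> (\<lambda>v. \<lambda>j\<in>J. v (r j)) \<in> borel_measurable (vec_borel I)"
    and J: "r ` J \<subseteq> I"
  shows "(\<integral>v. (h \<circ> (\<lambda>v. \<lambda>j\<in>J. v (r j))) v \<partial>distr Q (vec_borel I) (\<lambda>\<omega>. \<lambda>i\<in>I. Z i \<omega>))
    = (\<integral>v. h v \<partial>distr Q (vec_borel J) (\<lambda>\<omega>. \<lambda>j\<in>J. Z (r j) \<omega>))"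
proof -
  have eq: "(\<lambda>j\<in>J. (\<lambda>i\<in>I. Z i \<omega>) (r j)) = (\<lambda>j\<in>J. Z (r j) \<omega>)" for \<omega>
    using J by (intro restrict_ext) auto
  have m: "(\<lambda>\<omega>. \<lambda>i\<in>I. Z i \<omega>) \<in> measurable Q (vec_borel I)"
    "(\<lambda>\<omega>. \<lambda>j\<in>J. Z (r j) \<omega>) \<in> measurable Q (vec_borel J)"
    by (intro measurable_restrict Z)+
  show ?thesis
    unfolding integral_distr[OF m(2) h(1)] integral_distr[OF m(1) h(2)]
    unfolding comp_apply eq ..
qed

text \<open>Selecting and relabelling coordinates along \<open>r\<close> is continuous, so test
  functions pull back. In this way limits on symmetric windows of integer times transfer to blocks
  numbered from 1.\<close>

lemma weakly_converges_reindex: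
  fixes r :: "'j \<Rightarrow> 'i"
  assumes conv: "weakly_converges (powertop_real I)
      (\<lambda>x. distr (U x) (vec_borel I) (\<lambda>\<omega>. \<lambda>i\<in>I. V x i \<omega>)) (distr P (vec_borel I) (\<lambda>\<omega>. \<lambda>i\<in>I. W i \<omega>)) F"
    and I: "finite I" and J: "finite J" "r ` J \<subseteq> I"
    and V: "\<And>x i. V x i \<in> borel_measurable (U x)" and W: "\<And>i. W i \<in> borel_measurable P"
  shows "weakly_converges (powertop_real J)
      (\<lambda>x. distr (U x) (vec_borel J) (\<lambda>\<omega>. \<lambda>j\<in>J. V x (r j) \<omega>))
      (distr P (vec_borel J) (\<lambda>\<omega>. \<lambda>j\<in>J. W (r j) \<omega>)) F"
  unfolding weakly_converges_def
proof (intro allI impI, elim conjE)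
  fix h assume h: "continuous_map (powertop_real J) euclideanreal h" "bounded (h ` topspace (powertop_real J))"
  define \<rho> where "\<rho> = (\<lambda>v :: 'i \<Rightarrow> real. \<lambda>j\<in>J. v (r j))"
  have \<rho>: "continuous_map (powertop_real I) (powertop_real J) \<rho>"
    using J unfolding \<rho>_def continuous_map_componentwise
    by (auto intro!: continuous_map_powertop_real_proj)
  then have "continuous_map (powertop_real I) euclideanreal (h \<circ> \<rho>)"
    using h by (intro continuous_map_compose)
  moreover have "bounded ((h \<circ> \<rho>) ` topspace (powertop_real I))"
    unfolding image_comp[symmetric]
    using continuous_map_image_subset_topspace[OF \<rho>] by (intro bounded_subset[OF h(2)] image_mono)
  ultimately have lim: "((\<lambda>x. \<integral>v. (h \<circ> \<rho>) v \<partial>distr (U x) (vec_borel I) (\<lambda>\<omega>. \<lambda>i\<in>I. V x i \<omega>))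
      \<longlongrightarrow> (\<integral>v. (h \<circ> \<rho>) v \<partial>distr P (vec_borel I) (\<lambda>\<omega>. \<lambda>i\<in>I. W i \<omega>))) F"
    using conv unfolding weakly_converges_def by blast
  have m: "h \<in> borel_measurable (vec_borel J)" "h \<circ> \<rho> \<in> borel_measurable (vec_borel I)"
    using h(1) \<open>continuous_map (powertop_real I) euclideanreal (h \<circ> \<rho>)\<close> I J
    by (auto intro: continuous_map_imp_vec_borel_measurable)
  note eq = integral_distr_reindex[OF _ m[unfolded \<rho>_def] J(2), folded \<rho>_def]
  show "((\<lambda>x. \<integral>v. h v \<partial>distr (U x) (vec_borel J) (\<lambda>\<omega>. \<lambda>j\<in>J. V x (r j) \<omega>))
      \<longlongrightarrow> (\<integral>v. h v \<partial>distr P (vec_borel J) (\<lambda>\<omega>. \<lambda>j\<in>J. W (r j) \<omega>))) F"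
    using lim unfolding eq[OF V] eq[OF W] .
qed

text \<open>If the tail vanished at \<open>x\<close>, it would vanish beyond \<open>x\<close>, and
  the conditional laws would be null measures there. Testing weak convergence with the constant 1
  contradicts the total mass 1 of the limit. Positivity makes the conditional laws probability
  measures for every \<open>x\<close>.\<close>

lemma tail_process_tail_pos:
  assumes M: "prob_space M" and P: "prob_space P" and Y: "tail_process M \<alpha> X P Y"
    and X[measurable]: "\<And>t. X t \<in> borel_measurable M"
  shows "\<P>(\<omega> in M. \<bar>X 0 \<omega>\<bar> > x) > 0"
proof (rule ccontr)
  interpret M: prob_space M by fact
  interpret P: prob_space P by fact
  assume "\<not> ?thesis"
  then have x0: "\<P>(\<omega> in M. \<bar>X 0 \<omega>\<bar> > x) = 0" by (simp add: not_less measure_le_0_iff)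
  have Ym: "Y t \<in> borel_measurable P" for t using Y by (simp add: tail_process_def)
  define U where "U = (\<lambda>y. uniform_measure M {\<omega> \<in> space M. \<bar>X 0 \<omega>\<bar> > y})"
  define \<mu> where "\<mu> = (\<lambda>y. distr (U y) (vec_borel {- int 0..int 0}) (\<lambda>\<omega>. \<lambda>i\<in>{- int 0..int 0}. X i \<omega> / y))"
  define \<nu> where "\<nu> = distr P (vec_borel {- int 0..int 0}) (\<lambda>\<omega>. \<lambda>i\<in>{- int 0..int 0}. Y i \<omega>)"
  have "weakly_converges (powertop_real {- int 0..int 0}) \<mu> \<nu> at_top"
    using Y unfolding tail_process_def \<mu>_def \<nu>_def U_def by blast
  then have lim: "((\<lambda>y. \<integral>v. (1::real) \<partial>\<mu> y) \<longlongrightarrow> (\<integral>v. 1 \<partial>\<nu>)) at_top"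
    unfolding weakly_converges_def
    by (elim allE[of _ "\<lambda>_. 1"] mp) (auto intro: bounded_subset[of "{1}"])
  have \<nu>: "(\<integral>v. 1 \<partial>\<nu>) = (1::real)"
  proof -
    have "prob_space \<nu>" unfolding \<nu>_def by (intro P.prob_space_distr measurable_restrict Ym)
    then show ?thesis by (simp add: prob_space.prob_space)
  qed
  have \<mu>: "(\<integral>v. 1 \<partial>\<mu> y) = (0::real)" if "y \<ge> x" for y
  proof -
    have "\<P>(\<omega> in M. \<bar>X 0 \<omega>\<bar> > y) \<le> \<P>(\<omega> in M. \<bar>X 0 \<omega>\<bar> > x)"
      using that by (intro M.finite_measure_mono) auto
    then have "emeasure M {\<omega> \<in> space M. \<bar>X 0 \<omega>\<bar> > y} = 0"
      using x0 by (simp add: M.emeasure_eq_measure measure_le_0_iff)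
    \<comment> \<open>\<open>uniform_measure\<close> over a null event has mass
      \<open>0 / 0 = 0\<close>.\<close>
    then have "emeasure (U y) (space M) = 0" unfolding U_def
      by (subst emeasure_uniform_measure) (auto simp: Int_absorb2)
    then have "measure (U y) (space (U y)) = 0"
      by (simp add: measure_def U_def)
    moreover have "(\<lambda>\<omega>. \<lambda>i\<in>{- int 0..int 0}. X i \<omega> / y) \<in> measurable (U y) (vec_borel {- int 0..int 0})"
      unfolding U_def by (intro measurable_restrict) measurable
    then have "(\<lambda>\<omega>. \<lambda>i\<in>{- int 0..int 0}. X i \<omega> / y) -` space (vec_borel {- int 0..int 0}) \<inter> space (U y) = space (U y)"
      by (auto simp: measurable_def)
    ultimately show ?thesis
      using \<open>_ \<in> measurable (U y) _\<close> by (simp add: \<mu>_def measure_distr)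
  qed
  have "((\<lambda>y. \<integral>v. (1::real) \<partial>\<mu> y) \<longlongrightarrow> 0) at_top"
    by (rule tendsto_eventually) (rule eventually_mono[OF eventually_ge_at_top[of x] \<mu>])
  with lim \<nu> show False using tendsto_unique[OF trivial_limit_at_top_linorder] by fastforce
qed

lemma tail_process_weakly_converges:
  fixes r :: "'j \<Rightarrow> int"
  assumes Y: "tail_process M \<alpha> X P Y" and X: "\<And>t. X t \<in> borel_measurable M" and J: "finite J"
  shows "weakly_converges (powertop_real J)
      (\<lambda>x. distr (uniform_measure M {\<omega> \<in> space M. \<bar>X 0 \<omega>\<bar> > x}) (vec_borel J) (\<lambda>\<omega>. \<lambda>j\<in>J. X (r j) \<omega> / x))
      (distr P (vec_borel J) (\<lambda>\<omega>. \<lambda>j\<in>J. Y (r j) \<omega>)) at_top"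
proof -
  note [measurable] = X
  \<comment> \<open>A symmetric window that contains every time \<open>r j\<close>; the inserted 0
    covers an empty \<open>J\<close>.\<close>
  define k where "k = Max (insert 0 ((\<lambda>j. nat \<bar>r j\<bar>) ` J))"
  have "nat \<bar>r j\<bar> \<le> k" if "j \<in> J" for j unfolding k_def using that J by (intro Max_ge) auto
  then have "r ` J \<subseteq> {- int k..int k}" by fastforce
  moreover have "weakly_converges (powertop_real {- int k..int k})
        (\<lambda>x. distr (uniform_measure M {\<omega> \<in> space M. \<bar>X 0 \<omega>\<bar> > x}) (vec_borel {- int k..int k})
               (\<lambda>\<omega>. \<lambda>i\<in>{- int k..int k}. X i \<omega> / x))
        (distr P (vec_borel {- int k..int k}) (\<lambda>\<omega>. \<lambda>i\<in>{- int k..int k}. Y i \<omega>))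
        at_top"
    using Y unfolding tail_process_def by blast
  moreover have "Y t \<in> borel_measurable P" for t using Y by (simp add: tail_process_def)
  moreover have "(\<lambda>\<omega>. X t \<omega> / x) \<in> borel_measurable (uniform_measure M {\<omega> \<in> space M. \<bar>X 0 \<omega>\<bar> > x})" for t x
    by measurable
  ultimately show ?thesis
    by (intro weakly_converges_reindex[where V = "\<lambda>x t \<omega>. X t \<omega> / x" and W = Y
          and I = "{- int k..int k}", OF _ _ J]) (assumption | rule finite_atLeastAtMost_int)+
qed

lemma tail_process_expectation_tendsto:
  fixes r :: "'j \<Rightarrow> int" and h :: "('j \<Rightarrow> real) \<Rightarrow> real"
  assumes M: "prob_space M" and P: "prob_space P" and Y: "tail_process M \<alpha> X P Y"
    and X: "\<And>t. X t \<in> borel_measurable M" and J: "finite J"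
    and h: "h \<in> borel_measurable (vec_borel J)" "\<And>v. v \<in> J \<rightarrow>\<^sub>E UNIV \<Longrightarrow> \<bar>h v\<bar> \<le> B"
    and cont: "AE v in distr P (vec_borel J) (\<lambda>\<omega>. \<lambda>j\<in>J. Y (r j) \<omega>).
        topcontinuous_at (powertop_real J) euclideanreal h v"
  shows "((\<lambda>x. \<integral>\<omega>. h (\<lambda>j\<in>J. X (r j) \<omega> / x) \<partial>uniform_measure M {\<omega> \<in> space M. \<bar>X 0 \<omega>\<bar> > x})
      \<longlongrightarrow> (\<integral>\<omega>. h (\<lambda>j\<in>J. Y (r j) \<omega>) \<partial>P)) at_top"
proof -
  interpret M: prob_space M by fact
  interpret P: prob_space P by fact
  note [measurable] = X
  have Ym: "Y t \<in> borel_measurable P" for t using Y by (simp add: tail_process_def)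
  define U where "U = (\<lambda>y. uniform_measure M {\<omega> \<in> space M. \<bar>X 0 \<omega>\<bar> > y})"
  have U: "prob_space (U x)" for x
    unfolding U_def using tail_process_tail_pos[OF M P Y X, of x]
    by (intro prob_space_uniform_measure) (auto simp: M.emeasure_eq_measure)
  have mX: "(\<lambda>\<omega>. \<lambda>j\<in>J. X (r j) \<omega> / x) \<in> measurable (U x) (vec_borel J)" for x
    unfolding U_def by (intro measurable_restrict) measurable
  have mY: "(\<lambda>\<omega>. \<lambda>j\<in>J. Y (r j) \<omega>) \<in> measurable P (vec_borel J)"
    by (intro measurable_restrict Ym)
  have "((\<lambda>x. \<integral>v. h v \<partial>distr (U x) (vec_borel J) (\<lambda>\<omega>. \<lambda>j\<in>J. X (r j) \<omega> / x))
      \<longlongrightarrow> (\<integral>v. h v \<partial>distr P (vec_borel J) (\<lambda>\<omega>. \<lambda>j\<in>J. Y (r j) \<omega>))) at_top"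
    using tail_process_weakly_converges[OF Y X J, of r] prob_space.prob_space_distr[OF U mX] h
    by (intro weakly_converges_integral[OF J _ _ P.prob_space_distr[OF mY] _ _ _ cont, where B = B])
      (auto simp: U_def)
  then show ?thesis unfolding integral_distr[OF mX h(1)] integral_distr[OF mY h(1)] unfolding U_def .
qed

section \<open>Conditional probabilities and their limits\<close>

lemma integral_of_bool: "(\<integral>\<omega>. of_bool (Q \<omega>) \<partial>M) = \<P>(\<omega> in M. Q \<omega>)"
proof -
  have "(\<integral>\<omega>. of_bool (Q \<omega>) \<partial>M) = (\<integral>\<omega>. indicator {\<omega> \<in> space M. Q \<omega>} \<omega> \<partial>M)"
    by (intro Bochner_Integration.integral_cong) auto
  \<comment> \<open>For an event outside the sigma-algebra both sides take the default value
    0.\<close>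
  also have "\<dots> = \<P>(\<omega> in M. Q \<omega>)"
    by (simp add: Int_absorb2)
  finally show ?thesis .
qed

lemma (in prob_space) prob_uniform_measure_Collect:
  assumes "Measurable.pred M A" "Measurable.pred M Q"
  shows "\<P>(\<omega> in uniform_measure M {\<omega> \<in> space M. A \<omega>}. Q \<omega>) = \<P>(\<omega> in M. A \<omega> \<and> Q \<omega>) / \<P>(\<omega> in M. A \<omega>)"
  using measure_uniform_measure_eq_cond_prob[OF assms(2,1)] by (simp add: cond_prob_def conj_commute)

text \<open>The indicator of the event is in general discontinuous, but (C_1) makes it continuous
  almost everywhere for the two laws in \<open>tail_ref\<close>, and for \<open>s = 0\<close> and
  \<open>s = 1\<close> these are exactly the laws of the limiting blocks.\<close>

lemma tail_process_cluster_prob_tendsto: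
  assumes M: "prob_space M" and P: "prob_space P" and Y: "tail_process M \<alpha> X P Y"
    and X[measurable]: "\<And>t. X t \<in> borel_measurable M"
    and C0: "condition_C N 0 c" and C1: "condition_C (tail_ref P Y) \<epsilon> (exceedance_indicator c)"
    and l: "1 \<le> l" and s: "s \<in> {0, 1}"
  shows "((\<lambda>x. \<P>(\<omega> in M. \<bar>X 0 \<omega>\<bar> > x \<and> cluster_exceeds c l (\<lambda>i. X (s + int i - 1) \<omega> / x))
        / \<P>(\<omega> in M. \<bar>X 0 \<omega>\<bar> > x))
      \<longlongrightarrow> \<P>(\<omega> in P. cluster_exceeds c l (\<lambda>i. Y (s + int i - 1) \<omega>))) at_top"
proof -
  interpret M: prob_space M by fact
  define U where "U = (\<lambda>x. uniform_measure M {\<omega> \<in> space M. \<bar>X 0 \<omega>\<bar> > x})"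
  have meas: "exceedance_indicator c l \<in> borel_measurable (vec_borel {1..l})"
  proof -
    have "\<forall>l\<ge>1. exceedance_indicator c l \<in> borel_measurable (vec_borel {1..l})"
      using C1 unfolding condition_C_def by (elim conjE)
    with l show ?thesis by blast
  qed
  have "\<forall>l\<ge>1. \<forall>\<nu>\<in>tail_ref P Y l. AE x in \<nu>. topcontinuous_at (powertop_real {1..l}) euclideanreal
      (exceedance_indicator c l) x"
    using C1 unfolding condition_C_def by (elim conjE)
  moreover have "distr P (vec_borel {1..l}) (\<lambda>\<omega>. \<lambda>i\<in>{1..l}. Y (s + int i - 1) \<omega>) \<in> tail_ref P Y l"
    unfolding tail_ref_def using s by (rule imageI)
  ultimately have cont: "AE v in distr P (vec_borel {1..l}) (\<lambda>\<omega>. \<lambda>i\<in>{1..l}. Y (s + int i - 1) \<omega>).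
      topcontinuous_at (powertop_real {1..l}) euclideanreal (exceedance_indicator c l) v"
    using l by blast
  have "((\<lambda>x. \<integral>\<omega>. exceedance_indicator c l (\<lambda>i\<in>{1..l}. X (s + int i - 1) \<omega> / x) \<partial>U x)
      \<longlongrightarrow> (\<integral>\<omega>. exceedance_indicator c l (\<lambda>i\<in>{1..l}. Y (s + int i - 1) \<omega>) \<partial>P)) at_top"
    unfolding U_def
    by (rule tail_process_expectation_tendsto[OF M P Y X _ meas _ cont, where B = 1])
      (simp_all add: exceedance_indicator_eq)
  moreover have "\<P>(\<omega> in U x. cluster_exceeds c l (\<lambda>i. X (s + int i - 1) \<omega> / x))
      = \<P>(\<omega> in M. \<bar>X 0 \<omega>\<bar> > x \<and> cluster_exceeds c l (\<lambda>i. X (s + int i - 1) \<omega> / x))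
        / \<P>(\<omega> in M. \<bar>X 0 \<omega>\<bar> > x)" for x
    unfolding U_def by (intro M.prob_uniform_measure_Collect pred_cluster_exceeds[OF C0]) measurable
  ultimately show ?thesis
    unfolding exceedance_indicator_restrict integral_of_bool by simp
qed

text \<open>The piecewise linear function \<open>min 1 (N \<Sum>\<^sub>t (|v\<^sub>t| - 1)\<^sub>+)\<close> is a continuous minorant of
  the indicator of \<open>max\<^sub>t |v\<^sub>t| > 1\<close>, and increases to it as \<open>N \<rightarrow> \<infinity>\<close>.\<close>

lemma tail_process_exceedance_le:
  assumes M: "prob_space M" and P: "prob_space P" and Y: "tail_process M \<alpha> X P Y"
    and X[measurable]: "\<And>t. X t \<in> borel_measurable M" and J: "finite J"
    and freq: "\<exists>\<^sub>F x in at_top. \<P>(\<omega> in M. \<bar>X 0 \<omega>\<bar> > x \<and> (\<exists>t\<in>J. \<bar>X t \<omega>\<bar> > x))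
        / \<P>(\<omega> in M. \<bar>X 0 \<omega>\<bar> > x) \<le> e"
  shows "\<P>(\<omega> in P. \<exists>t\<in>J. \<bar>Y t \<omega>\<bar> > 1) \<le> e"
proof -
  interpret M: prob_space M by fact
  interpret P: prob_space P by fact
  have Ym[measurable]: "Y t \<in> borel_measurable P" for t using Y by (simp add: tail_process_def)
  define S where "S = (\<lambda>v :: int \<Rightarrow> real. \<Sum>t\<in>J. max (\<bar>v t\<bar> - 1) 0)"
  define u where "u = (\<lambda>(N::nat) v. min 1 (real N * S v))"
  define U where "U = (\<lambda>x. uniform_measure M {\<omega> \<in> space M. \<bar>X 0 \<omega>\<bar> > x})"
  have U: "prob_space (U x)" for x
    unfolding U_def using tail_process_tail_pos[OF M P Y X, of x]
    by (intro prob_space_uniform_measure) (auto simp: M.emeasure_eq_measure)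
  have S0: "S v \<ge> 0" for v unfolding S_def by (intro sum_nonneg) auto
  have u: "0 \<le> u N v" "u N v \<le> 1" for N v using S0 by (auto simp: u_def)
  have S_restrict: "S (restrict z J) = S z" for z
    unfolding S_def by (intro sum.cong) auto
  have S_meas[measurable]: "(\<lambda>\<omega>. S (\<lambda>t. Z t \<omega>)) \<in> borel_measurable Q"
    if [measurable]: "\<And>t. Z t \<in> borel_measurable Q" for Q :: "'c measure" and Z
    unfolding S_def by measurable
  have u_cont: "continuous_map (powertop_real J) euclideanreal (u N)" for N
    unfolding u_def S_def
    by (intro continuous_map_real_min continuous_map_real_mult continuous_map_sum J
        continuous_map_real_max continuous_map_diff continuous_map_real_abs
        continuous_map_powertop_real_proj continuous_map_const[THEN iffD2]) auto
  have lim: "((\<lambda>x. \<integral>\<omega>. u N (\<lambda>t\<in>J. X t \<omega> / x) \<partial>U x) \<longlongrightarrow> (\<integral>\<omega>. u N (\<lambda>t\<in>J. Y t \<omega>) \<partial>P)) at_top" for N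
    unfolding U_def
  proof (rule tail_process_expectation_tendsto[OF M P Y X J, where B = 1])
    show "u N \<in> borel_measurable (vec_borel J)"
      by (rule continuous_map_imp_vec_borel_measurable[OF J u_cont])
    show "AE v in distr P (vec_borel J) (\<lambda>\<omega>. \<lambda>t\<in>J. Y t \<omega>). topcontinuous_at (powertop_real J) euclideanreal (u N) v"
      using u_cont[of N] unfolding continuous_map_eq_topcontinuous_at by (intro AE_I2) (simp add: space_PiM)
  qed (use u in \<open>simp add: abs_le_iff\<close>)
  have le_e: "(\<integral>\<omega>. u N (\<lambda>t. Y t \<omega>) \<partial>P) \<le> e" for N
  proof (rule ccontr)
    assume "\<not> ?thesis"
    then have "\<forall>\<^sub>F x in at_top. e < (\<integral>\<omega>. u N (\<lambda>t. X t \<omega> / x) \<partial>U x)"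
      using lim[of N] by (intro order_tendstoD(1)) (auto simp: u_def S_restrict)
    \<comment> \<open>The hypothesis supplies arbitrarily large good \<open>x\<close>, not all large
      ones. This suffices, since the expectations of the continuous minorant converge along all
      \<open>x\<close>.\<close>
    then have "\<exists>\<^sub>F x in at_top. \<P>(\<omega> in M. \<bar>X 0 \<omega>\<bar> > x \<and> (\<exists>t\<in>J. \<bar>X t \<omega>\<bar> > x))
        / \<P>(\<omega> in M. \<bar>X 0 \<omega>\<bar> > x) \<le> e \<and> e < (\<integral>\<omega>. u N (\<lambda>t. X t \<omega> / x) \<partial>U x) \<and> 0 < x"
      by (intro frequently_eventually_frequently[OF freq] eventually_conj eventually_gt_at_top)
    then obtain x where x: "\<P>(\<omega> in M. \<bar>X 0 \<omega>\<bar> > x \<and> (\<exists>t\<in>J. \<bar>X t \<omega>\<bar> > x))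
        / \<P>(\<omega> in M. \<bar>X 0 \<omega>\<bar> > x) \<le> e" "e < (\<integral>\<omega>. u N (\<lambda>t. X t \<omega> / x) \<partial>U x)" "0 < x"
      by (blast dest: frequently_ex)
    interpret U: prob_space "U x" by (rule U)
    have [measurable]: "X t \<in> borel_measurable (U x)" for t unfolding U_def by measurable
    have [measurable]: "Measurable.pred (U x) (\<lambda>\<omega>. \<exists>t\<in>J. \<bar>X t \<omega>\<bar> > x)"
      "Measurable.pred M (\<lambda>\<omega>. \<exists>t\<in>J. \<bar>X t \<omega>\<bar> > x)"
      using J by measurable
    have "(\<integral>\<omega>. u N (\<lambda>t. X t \<omega> / x) \<partial>U x) \<le> (\<integral>\<omega>. of_bool (\<exists>t\<in>J. \<bar>X t \<omega>\<bar> > x) \<partial>U x)"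
    proof (rule integral_mono)
      show "integrable (U x) (\<lambda>\<omega>. u N (\<lambda>t. X t \<omega> / x))"
        using u by (intro U.integrable_const_bound[where B = 1]) (auto simp: u_def)
      show "integrable (U x) (\<lambda>\<omega>. of_bool (\<exists>t\<in>J. \<bar>X t \<omega>\<bar> > x) :: real)"
        by (intro U.integrable_const_bound[where B = 1]) auto
      fix \<omega>
      have "S (\<lambda>t. X t \<omega> / x) = 0" if "\<not> (\<exists>t\<in>J. \<bar>X t \<omega>\<bar> > x)"
        unfolding S_def using that x(3) by (intro sum.neutral) (auto simp: not_less abs_divide)
      then show "u N (\<lambda>t. X t \<omega> / x) \<le> of_bool (\<exists>t\<in>J. \<bar>X t \<omega>\<bar> > x)"
        using u(2)[of N "\<lambda>t. X t \<omega> / x"] by (auto simp: u_def)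
    qed
    also have "\<dots> = \<P>(\<omega> in M. \<bar>X 0 \<omega>\<bar> > x \<and> (\<exists>t\<in>J. \<bar>X t \<omega>\<bar> > x)) / \<P>(\<omega> in M. \<bar>X 0 \<omega>\<bar> > x)"
      unfolding integral_of_bool U_def by (intro M.prob_uniform_measure_Collect) measurable
    finally show False using x by linarith
  qed
  have "(\<lambda>N. \<integral>\<omega>. u N (\<lambda>t. Y t \<omega>) \<partial>P) \<longlonglongrightarrow> (\<integral>\<omega>. of_bool (\<exists>t\<in>J. \<bar>Y t \<omega>\<bar> > 1) \<partial>P)"
  proof (rule integral_dominated_convergence[where w = "\<lambda>_. 1"])
    show "AE \<omega> in P. (\<lambda>N. u N (\<lambda>t. Y t \<omega>)) \<longlonglongrightarrow> of_bool (\<exists>t\<in>J. \<bar>Y t \<omega>\<bar> > 1)"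
    proof (rule AE_I2)
      fix \<omega>
      show "(\<lambda>N. u N (\<lambda>t. Y t \<omega>)) \<longlonglongrightarrow> of_bool (\<exists>t\<in>J. \<bar>Y t \<omega>\<bar> > 1)"
      proof (cases "\<exists>t\<in>J. \<bar>Y t \<omega>\<bar> > 1")
        case True
        then obtain t where t: "t \<in> J" "\<bar>Y t \<omega>\<bar> > 1" by blast
        have "0 < max (\<bar>Y t \<omega>\<bar> - 1) 0" using t by auto
        also have "\<dots> \<le> S (\<lambda>t. Y t \<omega>)"
          unfolding S_def using t J by (intro member_le_sum) auto
        finally have S: "S (\<lambda>t. Y t \<omega>) > 0" .
        obtain N0 :: nat where N0: "real N0 > 1 / S (\<lambda>t. Y t \<omega>)" using reals_Archimedean2 by blast
        have "u N (\<lambda>t. Y t \<omega>) = 1" if "N \<ge> N0" for N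
        proof -
          have "real N > 1 / S (\<lambda>t. Y t \<omega>)" using N0 that by linarith
          then have "real N * S (\<lambda>t. Y t \<omega>) \<ge> 1" using S by (simp add: field_simps)
          then show ?thesis by (simp add: u_def)
        qed
        then have "\<forall>\<^sub>F N in sequentially. u N (\<lambda>t. Y t \<omega>) = 1"
          by (rule eventually_sequentiallyI)
        then show ?thesis using True by (simp add: tendsto_eventually)
      next
        case False
        then have "S (\<lambda>t. Y t \<omega>) = 0" unfolding S_def by (intro sum.neutral) auto
        with False show ?thesis by (simp add: u_def)
      qed
    qed
    show "AE \<omega> in P. norm (u N (\<lambda>t. Y t \<omega>)) \<le> 1" for N using u by (simp add: abs_le_iff)
    show "(\<lambda>\<omega>. of_bool (\<exists>t\<in>J. \<bar>Y t \<omega>\<bar> > 1) :: real) \<in> borel_measurable P"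
      using J by measurable
    show "(\<lambda>\<omega>. u N (\<lambda>t. Y t \<omega>)) \<in> borel_measurable P" for N unfolding u_def by measurable
  qed simp
  then show ?thesis
    unfolding integral_of_bool by (rule LIMSEQ_le_const2) (use le_e in auto)
qed

text \<open>Continuity from below as the window grows; it works because the bound \<open>e\<close>
  is the same for every window end \<open>m\<close>.\<close>

lemma tail_process_late_exceedance_le:
  assumes M: "prob_space M" and P: "prob_space P" and Y: "tail_process M \<alpha> X P Y"
    and X: "\<And>t. X t \<in> borel_measurable M"
    and freq: "\<And>m :: nat. \<exists>\<^sub>F x in at_top.
      \<P>(\<omega> in M. \<bar>X 0 \<omega>\<bar> > x \<and> (\<exists>t\<in>{k..int m}. \<bar>X t \<omega>\<bar> > x)) / \<P>(\<omega> in M. \<bar>X 0 \<omega>\<bar> > x) \<le> e"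
  shows "\<P>(\<omega> in P. \<exists>t\<ge>k. \<bar>Y t \<omega>\<bar> > 1) \<le> e"
proof -
  interpret P: prob_space P by fact
  have Ym[measurable]: "Y t \<in> borel_measurable P" for t using Y by (simp add: tail_process_def)
  define A where "A = (\<lambda>m. {\<omega> \<in> space P. \<exists>t\<in>{k..int m}. \<bar>Y t \<omega>\<bar> > 1})"
  have "(\<lambda>m. P.prob (A m)) \<longlonglongrightarrow> P.prob (\<Union>m. A m)"
  proof (rule P.finite_Lim_measure_incseq)
    show "range A \<subseteq> P.events" unfolding A_def by auto
    show "incseq A" unfolding A_def incseq_def by fastforce
  qed
  moreover have "P.prob (A m) \<le> e" for m
    unfolding A_def by (rule tail_process_exceedance_le[OF M P Y X _ freq]) simp
  ultimately have "P.prob (\<Union>m. A m) \<le> e" by (intro LIMSEQ_le_const2) auto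
  moreover have "(\<Union>m. A m) = {\<omega> \<in> space P. \<exists>t\<ge>k. \<bar>Y t \<omega>\<bar> > 1}"
  proof (intro equalityI subsetI)
    fix \<omega> assume "\<omega> \<in> {\<omega> \<in> space P. \<exists>t\<ge>k. \<bar>Y t \<omega>\<bar> > 1}"
    then obtain t where "\<omega> \<in> space P" "k \<le> t" "\<bar>Y t \<omega>\<bar> > 1" by blast
    then have "\<omega> \<in> A (nat t)" by (auto simp: A_def intro!: bexI[of _ t])
    then show "\<omega> \<in> (\<Union>m. A m)" by blast
  qed (auto simp: A_def)
  ultimately show ?thesis by simp
qed

section \<open>The tail process recovered from its spectral process\<close>

lemma tail_process_AE_nonzero:
  assumes P: "prob_space P" and Y: "tail_process M \<alpha> X P Y"
  shows "AE \<omega> in P. Y 0 \<omega> \<noteq> 0"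
proof -
  interpret P: prob_space P by fact
  have [measurable]: "Y t \<in> borel_measurable P" for t using Y by (simp add: tail_process_def)
  \<comment> \<open>The tail of \<open>|Y 0|\<close> is prescribed only at levels above 1, so the
    level decreases to 1. The value 0 has to be excluded because there
    \<open>|Y 0| * (Y t / |Y 0|)\<close> would be 0 whatever \<open>Y t\<close> is.\<close>
  have le: "(1 + 1 / real (Suc n)) powr - \<alpha> \<le> \<P>(\<omega> in P. Y 0 \<omega> \<noteq> 0)" for n
  proof -
    have "\<P>(\<omega> in P. \<bar>Y 0 \<omega>\<bar> > 1 + 1 / real (Suc n)) = (1 + 1 / real (Suc n)) powr - \<alpha>"
      using Y unfolding tail_process_def by (simp del: of_nat_Suc)
    moreover have "\<P>(\<omega> in P. \<bar>Y 0 \<omega>\<bar> > 1 + 1 / real (Suc n)) \<le> \<P>(\<omega> in P. Y 0 \<omega> \<noteq> 0)"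
    proof (rule P.finite_measure_mono)
      have "0 < 1 + 1 / real (Suc n)" by (simp add: add_pos_nonneg)
      then show "{\<omega> \<in> space P. \<bar>Y 0 \<omega>\<bar> > 1 + 1 / real (Suc n)} \<subseteq> {\<omega> \<in> space P. Y 0 \<omega> \<noteq> 0}"
        by auto
    qed measurable
    ultimately show ?thesis by simp
  qed
  have "(\<lambda>n. (1 + 1 / real (Suc n)) powr - \<alpha>) \<longlonglongrightarrow> (1 + 0) powr - \<alpha>"
    by (intro tendsto_powr tendsto_add tendsto_const LIMSEQ_Suc[OF lim_1_over_n]) auto
  then have "1 \<le> \<P>(\<omega> in P. Y 0 \<omega> \<noteq> 0)"
    using le by (intro LIMSEQ_le_const2) auto
  then have "\<P>(\<omega> in P. Y 0 \<omega> \<noteq> 0) = 1" by (simp add: antisym)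
  then show ?thesis by (subst (asm) P.prob_Collect_eq_1) auto
qed

text \<open>Almost surely \<open>Y t\<close> is \<open>|Y 0|\<close> times the spectral process.
  Cutting the sequence at length \<open>k\<close> then matters only if an entry beyond
  \<open>k\<close> exceeds 1, and such an entry sits at a time \<open>s + i - 1 \<ge> k\<close>, as
  \<open>s \<ge> 0\<close>.\<close>

lemma spectral_eval_seq_prob_approx:
  assumes P: "prob_space P" and Y: "tail_process M \<alpha> X P Y" and C: "condition_C N 0 c"
    and k: "1 \<le> k" and s: "0 \<le> s"
  shows "\<bar>\<P>(\<omega> in P. eval_seq c (\<lambda>i. pos_part (\<bar>Y 0 \<omega>\<bar> * spectral_tail_process Y (s + int i - 1) \<omega> - 1)) > 1)
      - \<P>(\<omega> in P. cluster_exceeds c k (\<lambda>i. Y (s + int i - 1) \<omega>))\<bar>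
    \<le> \<P>(\<omega> in P. \<exists>t\<ge>int k. \<bar>Y t \<omega>\<bar> > 1)"
proof -
  interpret P: prob_space P by fact
  have [measurable]: "Y t \<in> borel_measurable P" for t using Y by (simp add: tail_process_def)
  have ev: "{\<omega> \<in> space P. eval_seq c (\<lambda>i. pos_part (Z i \<omega> - 1)) > 1} \<in> P.events"
    if "\<And>i. Z i \<in> borel_measurable P" for Z
    using pred_eval_seq_gt_1[OF C that] by simp
  have "\<P>(\<omega> in P. eval_seq c (\<lambda>i. pos_part (\<bar>Y 0 \<omega>\<bar> * spectral_tail_process Y (s + int i - 1) \<omega> - 1)) > 1)
      = \<P>(\<omega> in P. eval_seq c (\<lambda>i. pos_part (Y (s + int i - 1) \<omega> - 1)) > 1)"
  proof (rule P.prob_eq_AE)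
    show "AE \<omega> in P. (eval_seq c (\<lambda>i. pos_part (\<bar>Y 0 \<omega>\<bar> * spectral_tail_process Y (s + int i - 1) \<omega> - 1)) > 1)
        \<longleftrightarrow> eval_seq c (\<lambda>i. pos_part (Y (s + int i - 1) \<omega> - 1)) > 1"
      using tail_process_AE_nonzero[OF P Y] by eventually_elim (simp add: spectral_tail_process_def)
    show "{\<omega> \<in> space P. eval_seq c (\<lambda>i. pos_part (\<bar>Y 0 \<omega>\<bar> * spectral_tail_process Y (s + int i - 1) \<omega> - 1)) > 1}
        \<in> P.events"
      unfolding spectral_tail_process_def by (rule ev) measurable
    show "{\<omega> \<in> space P. eval_seq c (\<lambda>i. pos_part (Y (s + int i - 1) \<omega> - 1)) > 1} \<in> P.events"
      by (rule ev) measurable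
  qed
  moreover have "\<bar>\<P>(\<omega> in P. eval_seq c (\<lambda>i. pos_part (Y (s + int i - 1) \<omega> - 1)) > 1)
      - \<P>(\<omega> in P. cluster_exceeds c k (\<lambda>i. Y (s + int i - 1) \<omega>))\<bar> \<le> \<P>(\<omega> in P. \<exists>t\<ge>int k. \<bar>Y t \<omega>\<bar> > 1)"
  proof (rule P.abs_prob_diff_le)
    show "{\<omega> \<in> space P. cluster_exceeds c k (\<lambda>i. Y (s + int i - 1) \<omega>)} \<in> P.events"
      using pred_cluster_exceeds[OF C, of "\<lambda>i. Y (s + int i - 1)" P k] by simp
    fix \<omega> assume not: "\<not> (\<exists>t\<ge>int k. \<bar>Y t \<omega>\<bar> > 1)"
    have "Y (s + int i - 1) \<omega> \<le> 1" if "i > k" for i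
    proof -
      have "\<not> \<bar>Y (s + int i - 1) \<omega>\<bar> > 1" using not that s by auto
      then show ?thesis by simp
    qed
    then show "(eval_seq c (\<lambda>i. pos_part (Y (s + int i - 1) \<omega> - 1)) > 1)
        \<longleftrightarrow> cluster_exceeds c k (\<lambda>i. Y (s + int i - 1) \<omega>)"
      by (rule eval_seq_gt_1_iff[OF C k])
  next
    show "{\<omega> \<in> space P. eval_seq c (\<lambda>i. pos_part (Y (s + int i - 1) \<omega> - 1)) > 1} \<in> P.events"
      by (rule ev) measurable
    show "{\<omega> \<in> space P. \<exists>t\<ge>int k. \<bar>Y t \<omega>\<bar> > 1} \<in> P.events" by measurable
  qed
  ultimately show ?thesis by simp
qed

section \<open>Uniform convergence\<close>

text \<open>In \<open>ennreal\<close> the empty supremum is 0, so an eventual bound uniform over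
  \<open>S n\<close> suffices whether or not \<open>S n\<close> is empty.\<close>

lemma tendsto_SUP_ennreal_0:
  fixes f :: "nat \<Rightarrow> 'a \<Rightarrow> real"
  assumes "\<And>e. e > 0 \<Longrightarrow> \<forall>\<^sub>F n in sequentially. \<forall>x\<in>S n. f n x \<le> e"
  shows "(\<lambda>n. SUP x\<in>S n. ennreal (f n x)) \<longlonglongrightarrow> 0"
proof (rule order_tendstoI)
  fix a :: ennreal assume "0 < a"
  then obtain b where b: "0 < b" "b < a" using dense by blast
  then have "b < top" using less_top order.strict_trans2 top_greatest by blast
  then obtain e where e: "b = ennreal e" "e > 0"
    using b(1) by (cases b) auto
  have "\<forall>\<^sub>F n in sequentially. \<forall>x\<in>S n. f n x \<le> e" using assms e(2) .
  then show "\<forall>\<^sub>F n in sequentially. (SUP x\<in>S n. ennreal (f n x)) < a"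
  proof eventually_elim
    case (elim n)
    then have "(SUP x\<in>S n. ennreal (f n x)) \<le> b"
      unfolding e(1) by (intro SUP_least ennreal_leI) auto
    then show ?case using b(2) by (rule le_less_trans)
  qed
qed simp

lemma anti_clustering_eventually:
  fixes q :: "nat \<Rightarrow> nat \<Rightarrow> 'a \<Rightarrow> real"
  assumes lim: "(\<lambda>k. limsup (\<lambda>n. SUP x\<in>S n. ennreal (q k n x))) \<longlonglongrightarrow> 0" and e: "e > 0"
  shows "\<forall>\<^sub>F k in sequentially. \<forall>\<^sub>F n in sequentially. \<forall>x\<in>S n. q k n x \<le> e"
proof -
  have "\<forall>\<^sub>F k in sequentially. limsup (\<lambda>n. SUP x\<in>S n. ennreal (q k n x)) < ennreal e"
    using lim e by (intro order_tendstoD) auto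
  then show ?thesis
  proof eventually_elim
    case (elim k)
    from Limsup_lessD[OF elim] show ?case
    proof eventually_elim
      case (elim n)
      show ?case
      proof
        fix x assume "x \<in> S n"
        then have "ennreal (q k n x) \<le> (SUP x\<in>S n. ennreal (q k n x))" by (rule SUP_upper)
        also note elim
        \<comment> \<open>\<open>ennreal\<close> sends negative numbers to 0, so the sign of
          \<open>q k n x\<close> is distinguished.\<close>
        finally show "q k n x \<le> e"
          using e by (cases "q k n x \<ge> 0") (auto simp: ennreal_less_iff)
      qed
    qed
  qed
qed

theorem corollary4p16:
  fixes M :: "'a measure" and X :: "int \<Rightarrow> 'a \<Rightarrow> real"
    and P :: "'b measure" and Y \<Theta> :: "int \<Rightarrow> 'b \<Rightarrow> real"
    and \<alpha> :: real and \<Lambda> :: "nat \<Rightarrow> real set" and xn :: "nat \<Rightarrow> ereal"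
    and c :: "nat \<Rightarrow> (nat \<Rightarrow> real) \<Rightarrow> real"
    and N :: "nat \<Rightarrow> (nat \<Rightarrow> real) measure set"
  assumes "prob_space M" and "prob_space P"
    and "\<alpha> > 0"
    and "strictly_stationary M X"
    and "regularly_varying_sequence M \<alpha> X"
    and "tail_process M \<alpha> X P Y"
    and "\<Theta> = spectral_tail_process Y"
    and "\<And>n. \<Lambda> n \<in> sets borel" and "\<And>n. \<Lambda> n \<subseteq> {0<..}"
    and "\<And>n. xn n = (INF x\<in>\<Lambda> n. ereal x)"
    and "xn \<longlonglongrightarrow> \<infinity>"
    and "(\<lambda>n. real n * \<P>(\<omega> in M. ereal \<bar>X 0 \<omega>\<bar> > xn n)) \<longlonglongrightarrow> 0"
    and "\<And>\<delta>. \<delta> > 0 \<Longrightarrow>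
      (\<lambda>k::nat. limsup (\<lambda>n. SUP x\<in>\<Lambda> n.
         ennreal (\<P>(\<omega> in M. Max ((\<lambda>i. \<bar>X i \<omega>\<bar>) ` {int k..int n}) > x * \<delta> \<bar> \<bar>X 0 \<omega>\<bar> > x * \<delta>)))) \<longlonglongrightarrow> 0"
    and "N = lebesgue_ref \<or> N = tail_ref P Y"
    and "cluster_functional N c"
    and "condition_C (tail_ref P Y) 1 (exceedance_indicator c)"
  shows "(\<lambda>n. SUP x\<in>\<Lambda> n. ennreal
      \<bar>\<P>(\<omega> in M. c n (\<lambda>i\<in>{1..n}. pos_part (inverse x * X (int i) \<omega> - 1)) > 1)
          / (real n * \<P>(\<omega> in M. \<bar>X 0 \<omega>\<bar> > x))
        - (\<P>(\<omega> in P. eval_seq c (\<lambda>i. pos_part (\<bar>Y 0 \<omega>\<bar> * \<Theta> (int i - 1) \<omega> - 1)) > 1)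
         - \<P>(\<omega> in P. eval_seq c (\<lambda>i. pos_part (\<bar>Y 0 \<omega>\<bar> * \<Theta> (int i) \<omega> - 1)) > 1))\<bar>)
    \<longlonglongrightarrow> 0"
proof (rule tendsto_SUP_ennreal_0)
  interpret M: prob_space M by fact
  fix e0 :: real assume "e0 > 0"
  \<comment> \<open>Seven equal shares: one for the short blocks, two for anti-clustering, two for
    the limits in \<open>x\<close> at \<open>s = 0\<close> and \<open>s = 1\<close>, and two for
    cutting the tail process at length \<open>k\<close>.\<close>
  define e where "e = e0 / 7"
  have e: "e > 0" using \<open>e0 > 0\<close> by (simp add: e_def)
  note Y = assms(6)
  have X[measurable]: "\<And>t. X t \<in> borel_measurable M"
    using assms(4) by (simp add: strictly_stationary_def)
  have C0: "condition_C N 0 c" using assms(15) by (simp add: cluster_functional_def)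
  define p where "p = (\<lambda>x. \<P>(\<omega> in M. \<bar>X 0 \<omega>\<bar> > x))"
  have p: "p x > 0" for x unfolding p_def by (rule tail_process_tail_pos[OF assms(1,2) Y X])
  define T where "T = (\<lambda>(k::nat) (n::nat) x. \<P>(\<omega> in M. \<bar>X 0 \<omega>\<bar> > x \<and> (\<exists>t\<in>{int k..int n}. \<bar>X t \<omega>\<bar> > x)))"
  define A where "A = (\<lambda>s k x. \<P>(\<omega> in M. \<bar>X 0 \<omega>\<bar> > x \<and> cluster_exceeds c k (\<lambda>i. X (s + int i - 1) \<omega> / x)) / p x)"
  define B where "B = (\<lambda>s k. \<P>(\<omega> in P. cluster_exceeds c k (\<lambda>i. Y (s + int i - 1) \<omega>)))"
  define L where "L = (\<lambda>s. \<P>(\<omega> in P. eval_seq c (\<lambda>i. pos_part (\<bar>Y 0 \<omega>\<bar> * spectral_tail_process Y (s + int i - 1) \<omega> - 1)) > 1))"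

  \<comment> \<open>For \<open>k > n\<close> the window is empty and \<open>Max\<close> is
    unspecified; hence \<open>k \<le> n\<close>, which holds for all large \<open>n\<close>. The
    anti-clustering level is taken with \<open>\<delta> = 1\<close>.\<close>
  have T_cond: "\<P>(\<omega> in M. Max ((\<lambda>i. \<bar>X i \<omega>\<bar>) ` {int k..int n}) > x * 1 \<bar> \<bar>X 0 \<omega>\<bar> > x * 1) = T k n x / p x"
    if "k \<le> n" for k n x
  proof -
    have "Max ((\<lambda>i. \<bar>X i \<omega>\<bar>) ` {int k..int n}) > x \<longleftrightarrow> (\<exists>t\<in>{int k..int n}. \<bar>X t \<omega>\<bar> > x)" for \<omega>
      using that by (subst Max_gr_iff) auto
    then show ?thesis by (simp add: cond_prob_def T_def p_def conj_commute)
  qed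
  have "\<forall>\<^sub>F k in sequentially. k \<ge> 1 \<and> (\<forall>\<^sub>F n in sequentially. \<forall>x\<in>\<Lambda> n.
      \<P>(\<omega> in M. Max ((\<lambda>i. \<bar>X i \<omega>\<bar>) ` {int k..int n}) > x * 1 \<bar> \<bar>X 0 \<omega>\<bar> > x * 1) \<le> e)"
    by (intro eventually_conj eventually_ge_at_top anti_clustering_eventually assms(13) e) simp
  \<comment> \<open>This \<open>k\<close> stays fixed to the end while \<open>n\<close> grows, so
    that \<open>2 * k / n\<close> becomes small.\<close>
  then obtain k where k: "k \<ge> 1" and AC: "\<forall>\<^sub>F n in sequentially. \<forall>x\<in>\<Lambda> n.
      \<P>(\<omega> in M. Max ((\<lambda>i. \<bar>X i \<omega>\<bar>) ` {int k..int n}) > x * 1 \<bar> \<bar>X 0 \<omega>\<bar> > x * 1) \<le> e"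
    using eventually_happens'[OF sequentially_bot] by blast
  have AC': "\<forall>\<^sub>F n in sequentially. \<forall>x\<in>\<Lambda> n. T k n x / p x \<le> e"
    using AC eventually_ge_at_top[of k] by eventually_elim (use T_cond in auto)
  \<comment> \<open>As the infimum of \<open>\<Lambda> n\<close> tends to infinity, any limit as
    \<open>x\<close> tends to infinity becomes uniform over \<open>\<Lambda> n\<close>.\<close>
  have large: "\<forall>\<^sub>F n in sequentially. \<forall>x\<in>\<Lambda> n. x > b" for b
  proof -
    have "\<forall>\<^sub>F n in sequentially. xn n > ereal b" using assms(11) by (intro order_tendstoD) auto
    then show ?thesis
    proof eventually_elim
      case (elim n)
      show ?case
      proof
        fix x assume "x \<in> \<Lambda> n"
        then have "xn n \<le> ereal x" unfolding assms(10) by (rule INF_lower)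
        with elim show "x > b" by (metis less_le_trans ereal_less(1) less_ereal.simps(1))
      qed
    qed
  qed
  have conv: "\<forall>\<^sub>F n in sequentially. \<forall>x\<in>\<Lambda> n. \<bar>A s k x - B s k\<bar> \<le> e" if s: "s \<in> {0, 1}" for s
  proof -
    have "((\<lambda>x. A s k x) \<longlongrightarrow> B s k) at_top"
      unfolding A_def B_def p_def
      by (rule tail_process_cluster_prob_tendsto[OF assms(1,2) Y X C0 assms(16) k s])
    then have "\<forall>\<^sub>F x in at_top. dist (A s k x) (B s k) < e" using e by (rule tendstoD)
    then obtain b where b: "\<And>x. x \<ge> b \<Longrightarrow> dist (A s k x) (B s k) < e"
      by (auto simp: eventually_at_top_linorder)
    from large[of b] show ?thesis
      by eventually_elim (use b in \<open>auto simp: dist_real_def intro!: less_imp_le\<close>)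
  qed
  obtain n0 :: nat where n0: "real n0 > 2 * real k / e" using reals_Archimedean2 by blast
  have n0': "2 * real k / real n \<le> e" if "n \<ge> n0" "n \<ge> k" for n
  proof -
    have "2 * real k / e \<le> real n" using n0 that by linarith
    then show ?thesis using e k that by (simp add: field_simps)
  qed

  show "\<forall>\<^sub>F n in sequentially. \<forall>x\<in>\<Lambda> n.
      \<bar>\<P>(\<omega> in M. c n (\<lambda>i\<in>{1..n}. pos_part (inverse x * X (int i) \<omega> - 1)) > 1)
          / (real n * \<P>(\<omega> in M. \<bar>X 0 \<omega>\<bar> > x))
        - (\<P>(\<omega> in P. eval_seq c (\<lambda>i. pos_part (\<bar>Y 0 \<omega>\<bar> * \<Theta> (int i - 1) \<omega> - 1)) > 1)
         - \<P>(\<omega> in P. eval_seq c (\<lambda>i. pos_part (\<bar>Y 0 \<omega>\<bar> * \<Theta> (int i) \<omega> - 1)) > 1))\<bar> \<le> e0"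
  \<comment> \<open>If \<open>\<Lambda> n\<close> is eventually empty, the claim is vacuous, and
    anti-clustering says nothing about the tail process. Otherwise infinitely many nonempty
    \<open>\<Lambda> n\<close> provide arbitrarily large \<open>x\<close> at which the
    anti-clustering bound holds.\<close>
  proof (cases "\<exists>\<^sub>F n in sequentially. \<Lambda> n \<noteq> {}")
    case False
    then have "\<forall>\<^sub>F n in sequentially. \<Lambda> n = {}" by (simp add: frequently_def)
    then show ?thesis by eventually_elim simp
  next
    case True
    have "\<exists>\<^sub>F x in at_top. T k m x / p x \<le> e" for m
      unfolding frequently_def eventually_at_top_linorder
    proof (rule notI, elim exE)
      fix b assume b: "\<forall>x\<ge>b. \<not> T k m x / p x \<le> e"
      \<comment> \<open>To control the window up to \<open>m\<close> at some \<open>x > b\<close>, a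
        point of \<open>\<Lambda> n\<close> with \<open>n \<ge> m\<close> is used: its window up to
        \<open>n\<close> contains the one up to \<open>m\<close>.\<close>
      have "\<exists>\<^sub>F n in sequentially. \<Lambda> n \<noteq> {} \<and>
          (\<forall>x\<in>\<Lambda> n. T k n x / p x \<le> e) \<and> (\<forall>x\<in>\<Lambda> n. x > b) \<and> n \<ge> m"
        by (intro frequently_eventually_frequently[OF True] eventually_conj AC' large eventually_ge_at_top)
      then obtain n x where n: "x \<in> \<Lambda> n" "T k n x / p x \<le> e" "x > b" "n \<ge> m"
        by (blast dest: frequently_ex)
      have "T k m x \<le> T k n x"
        unfolding T_def
      proof (rule M.finite_measure_mono)
        show "{\<omega> \<in> space M. \<bar>X 0 \<omega>\<bar> > x \<and> (\<exists>t\<in>{int k..int m}. \<bar>X t \<omega>\<bar> > x)}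
            \<subseteq> {\<omega> \<in> space M. \<bar>X 0 \<omega>\<bar> > x \<and> (\<exists>t\<in>{int k..int n}. \<bar>X t \<omega>\<bar> > x)}"
          using n(4) by fastforce
      qed measurable
      then have "T k m x / p x \<le> T k n x / p x" using p[of x] by (intro divide_right_mono) auto
      then have "T k m x / p x \<le> e" using n(2) by linarith
      moreover have "b \<le> x" using n(3) by simp
      ultimately show False using b by blast
    qed
    then have late: "\<P>(\<omega> in P. \<exists>t\<ge>int k. \<bar>Y t \<omega>\<bar> > 1) \<le> e"
      unfolding T_def p_def by (rule tail_process_late_exceedance_le[OF assms(1,2) Y X])
    have L: "\<bar>L s - B s k\<bar> \<le> e" if "0 \<le> s" for s
      using spectral_eval_seq_prob_approx[OF assms(2) Y C0 k that] late by (simp add: L_def B_def)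
    have "\<forall>\<^sub>F n in sequentially. \<forall>x\<in>\<Lambda> n.
        \<bar>\<P>(\<omega> in M. cluster_exceeds c n (\<lambda>i. X (int i) \<omega> / x)) / (real n * p x) - (L 0 - L 1)\<bar> \<le> e0"
      using AC' conv[of 0, simplified] conv[of 1, simplified] eventually_ge_at_top[of n0] eventually_ge_at_top[of k]
    proof eventually_elim
      case (elim n)
      show ?case
      proof
        fix x assume x: "x \<in> \<Lambda> n"
        then have "x > 0" using assms(9) by auto
        have "\<bar>\<P>(\<omega> in M. cluster_exceeds c n (\<lambda>i. X (int i) \<omega> / x)) / (real n * p x) - (A 0 k x - A 1 k x)\<bar>
            \<le> 2 * real k / real n + 2 * (T k n x / p x)"
          unfolding A_def T_def p_def
          using p[of x] by (intro M.cluster_prob_approx[OF assms(4) C0 \<open>x > 0\<close> k]) (auto simp: p_def elim)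
        moreover have "T k n x / p x \<le> e" "\<bar>A 0 k x - B 0 k\<bar> \<le> e" "\<bar>A 1 k x - B 1 k\<bar> \<le> e"
          "2 * real k / real n \<le> e"
          using elim x n0' by auto
        moreover have "\<bar>L 0 - B 0 k\<bar> \<le> e" "\<bar>L 1 - B 1 k\<bar> \<le> e" "e0 = 7 * e"
          using L by (simp_all add: e_def)
        ultimately show "\<bar>\<P>(\<omega> in M. cluster_exceeds c n (\<lambda>i. X (int i) \<omega> / x)) / (real n * p x) - (L 0 - L 1)\<bar> \<le> e0"
          by linarith
      qed
    qed
    then show ?thesis
      by (simp add: cluster_exceeds_def L_def p_def assms(7) divide_inverse mult.commute)
  qed
qed

end
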